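(* Let $d\ge 2$ and $k\ge 1$ be fixed integers. Then for the even $d$-ary tree $E_k^d$ we have $$\max_{\substack{\|T\|=(d-1)n+1\\ T\text{ strictly }d\text{-ary tree}}}\gamma(E_k^d,T)=I_d(E_k^d)+\mathcal{O}(n^{-1})$$ as $n\to\infty$.
   Context: A $d$-ary tree is a finite rooted tree in which every internal (non-leaf) vertex has at least two and at most $d$ children; a single vertex is a $d$-ary tree with one leaf. A strictly $d$-ary tree is a rooted tree in which every internal vertex has exactly $d$ children (its number of leaves is always congruent to $1$ modulo $d-1$). Isomorphism means root-preserving isomorphism. $\|T\|$ denotes the number of leaves of $T$. A set $S$ of leaves of $T$ induces a $d$-ary tree: take the smallest subtree of $T$ containing all leaves in $S$ (rooted at the most recent common ancestor of $S$) and repeatedly suppress every vertex with exactly one child (contracting its two adjacent edges to a single edge). $c(D,T)$ is the number of sets of $\|D\|$ leaves of $T$ that induce a tree isomorphic to $D$, and $\gamma(D,T)=c(D,T)/\binom{\|T\|}{\|D\|}$. The $d$-ary inducibility of a $d$-ary tree $D$ is $$I_d(D)=\limsup_{n\to\infty}\ \max_{\substack{\|T\|=n\\ T\ d\text{-ary tree}}}\gamma(D,T).$$ Even $d$-ary trees $E_k^d$ (with $k$ leaves) are defined recursively: $E_1^d$ is a single vertex; for $2\le k\le d$, $E_k^d$ is the star consisting of a root and $k$ leaves attached to it; for $k>d$, write $k=ds+b$ with $b\in\{0,1,\ldots,d-1\}$, take $d-b$ copies of $E_s^d$ and $b$ copies of $E_{s+1}^d$, and connect a new common root to each of their roots by an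 edge to obtain $E_k^d$. *)

theory Defs
  imports Complex_Main "HOL-Library.Extended_Real" "HOL-Library.Landau_Symbols"
begin

text \<open>
  A finite rooted tree is represented by the list of the branches at its root. The order of the
  branches has no meaning: trees are compared up to \<open>isomorphic\<close> below. A vertex is addressed
  by the list of branch indices on the path leading to it from the root \<open>[]\<close>.
\<close>

datatype tree = Node "tree list"

lemma size_nth_branch [termination_simp]:
  fixes ts :: "tree list"
  shows "i < length ts \<Longrightarrow> size (ts ! i) < Suc (size_list size ts)"
  by (rule le_imp_less_Suc, rule size_list_estimation') auto

fun vertices :: "tree \<Rightarrow> nat list set" where
  "vertices (Node ts) = insert [] (\<Union>i\<in>{..<length ts}. (#) i ` vertices (ts ! i))"

definition child_of :: "nat list \<Rightarrow> nat list \<Rightarrow> bool" where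
  "child_of v u \<longleftrightarrow> (\<exists>i. v = u @ [i])"

definition leaves :: "tree \<Rightarrow> nat list set" where
  "leaves T = {u \<in> vertices T. \<not> (\<exists>v \<in> vertices T. child_of v u)}"

definition num_leaves :: "tree \<Rightarrow> nat" where
  "num_leaves T = card (leaves T)"

definition isomorphic :: "tree \<Rightarrow> tree \<Rightarrow> bool" where
  "isomorphic T U \<longleftrightarrow>
     (\<exists>f. bij_betw f (vertices T) (vertices U) \<and> f [] = [] \<and>
          (\<forall>u \<in> vertices T. \<forall>v \<in> vertices T. child_of v u \<longleftrightarrow> child_of (f v) (f u)))"

fun dary :: "nat \<Rightarrow> tree \<Rightarrow> bool" where
  "dary d (Node ts) \<longleftrightarrow>
     (ts = [] \<or> 2 \<le> length ts \<and> length ts \<le> d) \<and> (\<forall>t \<in> set ts. dary d t)"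

fun strictly_dary :: "nat \<Rightarrow> tree \<Rightarrow> bool" where
  "strictly_dary d (Node ts) \<longleftrightarrow>
     (ts = [] \<or> length ts = d) \<and> (\<forall>t \<in> set ts. strictly_dary d t)"

text \<open>
  \<open>prune S T\<close> keeps the root of \<open>T\<close> and every vertex that has an element of \<open>S\<close> at or below it.
\<close>

fun prune :: "nat list set \<Rightarrow> tree \<Rightarrow> tree" where
  "prune S (Node ts) =
     Node (map (\<lambda>i. prune {p. i # p \<in> S} (ts ! i))
               (filter (\<lambda>i. \<exists>p. i # p \<in> S) [0..<length ts]))"

fun suppress :: "tree \<Rightarrow> tree" where
  "suppress (Node []) = Node []"
| "suppress (Node [t]) = suppress t"
| "suppress (Node (t # u # us)) = Node (map suppress (t # u # us))"

text \<open>
  The vertices of the pruned tree strictly above the most recent common ancestor of \<open>S\<close> form a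
  path of vertices with one child each. \<open>suppress\<close> removes them with the other such vertices, so
  the result is rooted at the most recent common ancestor.
\<close>

definition induced :: "nat list set \<Rightarrow> tree \<Rightarrow> tree" where
  "induced S T = suppress (prune S T)"

definition copies :: "tree \<Rightarrow> tree \<Rightarrow> nat" where
  "copies D T =
     card {S. S \<subseteq> leaves T \<and> card S = num_leaves D \<and> isomorphic (induced S T) D}"

definition density :: "tree \<Rightarrow> tree \<Rightarrow> real" where
  "density D T = real (copies D T) / real (num_leaves T choose num_leaves D)"

text \<open>
  For \<open>d \<ge> 2\<close> and \<open>n \<ge> 1\<close> the set below is nonempty, and it is finite since densities of trees with \<open>n\<close>
  leaves have a common denominator and lie in \<open>[0, 1]\<close>; so the \<open>limsup\<close> is a real number.
\<close>

definition inducibility :: "nat \<Rightarrow> tree \<Rightarrow> real" where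
  "inducibility d D =
     real_of_ereal (limsup (\<lambda>n. ereal (Max {density D T | T. dary d T \<and> num_leaves T = n})))"

text \<open>The cases \<open>d < 2\<close> and \<open>k = 0\<close> are junk; the former is only there for termination.\<close>

function even_tree :: "nat \<Rightarrow> nat \<Rightarrow> tree" where
  "even_tree d k =
     (if d < 2 \<or> k \<le> 1 then Node []
      else if k \<le> d then Node (replicate k (Node []))
      else Node (replicate (d - k mod d) (even_tree d (k div d)) @
                 replicate (k mod d) (even_tree d (k div d + 1))))"
  by pat_completeness auto
termination
proof (relation "measure snd")
  fix d k :: nat
  assume a: "\<not> (d < 2 \<or> k \<le> 1)" "\<not> k \<le> d"
  then have "k div d \<le> k div 2"
    by (intro div_le_mono2) auto
  with a show "((d, k div d), (d, k)) \<in> measure snd"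
    and "((d, k div d + 1), (d, k)) \<in> measure snd"
    by auto
qed auto

declare even_tree.simps [simp del]

end

theory Submission
  imports Defs "HOL-Library.Multiset" "HOL-Library.FuncSet" "HOL-Combinatorics.Permutations"
begin

text \<open>
  Write \<open>k = d s + b\<close> with \<open>b < d\<close>. A leaf set of a tree with branches \<open>T\<^sub>1, \<dots>, T\<^sub>d\<close> (some of them
  possibly empty) induces \<open>E\<^sub>k\<close> iff it lies in one branch and induces \<open>E\<^sub>k\<close> there, or it meets \<open>b\<close>
  branches in copies of \<open>E\<^sub>s\<^sub>+\<^sub>1\<close> and the others in copies of \<open>E\<^sub>s\<close>. So if the numbers of copies of \<open>E\<^sub>s\<close>
  and \<open>E\<^sub>s\<^sub>+\<^sub>1\<close> are at most \<open>a\<^sub>s n\<^sup>s\<close> and \<open>a\<^sub>s\<^sub>+\<^sub>1 n\<^sup>s\<^sup>+\<^sup>1\<close>, then with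
  \<open>a\<^sub>k = (d choose b) a\<^sub>s\<^sup>d\<^sup>-\<^sup>b a\<^sub>s\<^sub>+\<^sub>1\<^sup>b / (d\<^sup>k - d)\<close> the number of copies of \<open>E\<^sub>k\<close> is at most \<open>a\<^sub>k n\<^sup>k\<close>: this
  reduces to Muirhead's inequality, the mean of the balanced monomials of degree \<open>k\<close> in \<open>x\<^sub>1, \<dots>, x\<^sub>d\<close>
  being the smallest among all monomial types. Strictly \<open>d\<close>-ary trees whose internal vertices are
  spread evenly over the branches contain \<open>a\<^sub>k n\<^sup>k - O(n\<^sup>k\<^sup>-\<^sup>1)\<close> copies. Hence \<open>I\<^sub>d(E\<^sub>k) = k! a\<^sub>k\<close>, and both
  maxima differ from this value by \<open>O(1/n)\<close>.
\<close>

section \<open>The Muirhead inequality for balanced monomials\<close>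

definition elem_sym :: "nat \<Rightarrow> nat \<Rightarrow> (nat \<Rightarrow> real) \<Rightarrow> real" where
  "elem_sym d b x = (\<Sum>B | B \<subseteq> {..<d} \<and> card B = b. \<Prod>i\<in>B. x i)"

text \<open>The arithmetic mean of the monomials of degree \<open>k\<close> in
  \<open>x 0, ..., x (d - 1)\<close> whose exponents differ by at most one: \<open>k mod d\<close>
  exponents are \<open>k div d + 1\<close>, the others \<open>k div d\<close>.\<close>

definition balanced_mean :: "nat \<Rightarrow> nat \<Rightarrow> (nat \<Rightarrow> real) \<Rightarrow> real" where
  "balanced_mean d k x =
     (\<Prod>i<d. x i) ^ (k div d) * (elem_sym d (k mod d) x / real (d choose (k mod d)))"

lemma elem_sym_0 [simp]: "elem_sym d 0 x = 1"
proof -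
  have "{B. B \<subseteq> {..<d} \<and> card B = 0} = {{}}"
    by (auto dest: finite_subset)
  then show ?thesis by (simp add: elem_sym_def)
qed

lemma elem_sym_full: "elem_sym d d x = (\<Prod>i<d. x i)"
proof -
  have "{B. B \<subseteq> {..<d} \<and> card B = d} = {{..<d}}"
    by (auto dest: card_subset_eq[rotated])
  then show ?thesis by (simp add: elem_sym_def)
qed

text \<open>Double counting of a set with a marked element: \<open>(R, i)\<close> with
  \<open>i\<close> outside \<open>R\<close> corresponds to \<open>(insert i R, i)\<close>. The
  weight stays general because it is used both for plain products and for sums over a second
  index.\<close>

lemma sum_subset_insert:
  fixes g :: "nat set \<Rightarrow> nat \<Rightarrow> real"
  shows "(\<Sum>R | R \<subseteq> {..<d} \<and> card R = b. \<Sum>i\<in>{..<d} - R. g R i)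
       = (\<Sum>B | B \<subseteq> {..<d} \<and> card B = Suc b. \<Sum>i\<in>B. g (B - {i}) i)"
proof -
  have fin: "finite {B. B \<subseteq> {..<d} \<and> card B = c}" for c
    by (rule finite_subset[of _ "Pow {..<d}"]) auto
  have fin': "finite B" if "B \<subseteq> {..<d}" for B
    using that finite_subset by blast
  have "(\<Sum>R | R \<subseteq> {..<d} \<and> card R = b. \<Sum>i\<in>{..<d} - R. g R i)
      = (\<Sum>(R, i)\<in>Sigma {R. R \<subseteq> {..<d} \<and> card R = b} (\<lambda>R. {..<d} - R). g R i)"
    by (rule sum.Sigma[OF fin]) simp
  also have "\<dots> = (\<Sum>(B, i)\<in>Sigma {B. B \<subseteq> {..<d} \<and> card B = Suc b} (\<lambda>B. B). g (B - {i}) i)"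
    by (rule sum.reindex_bij_witness[where i="\<lambda>(B, i). (B - {i}, i)" and j="\<lambda>(R, i). (insert i R, i)"])
       (auto simp: fin' card_insert_if insert_absorb subset_iff)
  also have "\<dots> = (\<Sum>B | B \<subseteq> {..<d} \<and> card B = Suc b. \<Sum>i\<in>B. g (B - {i}) i)"
    by (rule sum.Sigma[OF fin, symmetric]) (use fin' in blast)
  finally show ?thesis .
qed

lemma elem_sym_Suc:
  "(\<Sum>R | R \<subseteq> {..<d} \<and> card R = b. \<Sum>i\<in>{..<d} - R. (\<Prod>j\<in>R. x j) * x i)
     = real (Suc b) * elem_sym d (Suc b) x"
proof -
  have "(\<Sum>i\<in>B. (\<Prod>j\<in>B - {i}. x j) * x i) = real (Suc b) * (\<Prod>j\<in>B. x j)"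
    if "B \<subseteq> {..<d}" "card B = Suc b" for B
  proof -
    have "finite B" using that card_ge_0_finite by force
    then have "(\<Sum>i\<in>B. (\<Prod>j\<in>B - {i}. x j) * x i) = (\<Sum>i\<in>B. \<Prod>j\<in>B. x j)"
      by (intro sum.cong refl) (simp add: prod.remove[of B _ x] mult.commute)
    then show ?thesis using that by simp
  qed
  then show ?thesis
    unfolding sum_subset_insert elem_sym_def sum_distrib_left by (intro sum.cong refl) auto
qed

text \<open>Adding the sum to its copy with \<open>i\<close> and \<open>j\<close> exchanged gives
  the sum of the squares \<open>(x i - x j)^2\<close>.\<close>

lemma sum_swap_diff_nonneg:
  fixes x :: "nat \<Rightarrow> real"
  assumes "finite A"
  shows "0 \<le> (\<Sum>i\<in>A. \<Sum>j\<in>A - {i}. x i * (x i - x j))"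
proof -
  have "(\<Sum>i\<in>A. \<Sum>j\<in>A - {i}. x i * (x i - x j)) = (\<Sum>i\<in>A. \<Sum>j\<in>A. x i * (x i - x j))" (is "?L = ?S")
    proof (rule sum.cong[OF refl])
    fix i assume "i \<in> A"
    then show "(\<Sum>j\<in>A - {i}. x i * (x i - x j)) = (\<Sum>j\<in>A. x i * (x i - x j))"
      by (simp add: sum.remove[OF assms])
  qed
  moreover have "?S = (\<Sum>i\<in>A. \<Sum>j\<in>A. x j * (x j - x i))"
    by (rule sum.swap)
  then have "2 * ?S = (\<Sum>i\<in>A. \<Sum>j\<in>A. x i * (x i - x j) + x j * (x j - x i))"
    by (simp add: sum.distrib)
  also have "\<dots> = (\<Sum>i\<in>A. \<Sum>j\<in>A. (x i - x j)\<^sup>2)"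
    by (intro sum.cong refl) (simp add: power2_eq_square algebra_simps)
  also have "\<dots> \<ge> 0"
    by (intro sum_nonneg) auto
  ultimately show ?thesis by simp
qed

text \<open>The difference of the two sides is the sum of \<open>(\<Prod>j\<in>R. x j) * x i * (x i - x j)\<close> over all
  \<open>R\<close> with \<open>b - 1\<close> elements and all \<open>i \<noteq> j\<close> outside \<open>R\<close>; exchanging \<open>i\<close> and \<open>j\<close> produces squares.\<close>

lemma elem_sym_newton:
  assumes nn: "\<And>i. i < d \<Longrightarrow> 0 \<le> x i" and "b < d"
  shows "real d * (real (Suc b) * elem_sym d (Suc b) x) \<le> real (d - b) * ((\<Sum>i<d. x i) * elem_sym d b x)"
proof (cases b)
  case 0
  have "(\<Sum>R | R \<subseteq> {..<d} \<and> card R = 0. \<Sum>i\<in>{..<d} - R. (\<Prod>j\<in>R. x j) * x i) = (\<Sum>i<d. x i)"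
  proof -
    have "{B. B \<subseteq> {..<d} \<and> card B = 0} = {{}}"
      by (auto dest: finite_subset)
    then show ?thesis by simp
  qed
  then show ?thesis using 0 elem_sym_Suc[where d=d and b=0 and x=x] by simp
next
  case (Suc c)
  let ?F = "{B. B \<subseteq> {..<d} \<and> card B = b}"
  let ?P = "\<lambda>B. \<Prod>j\<in>B. x j"
  have "0 \<le> (\<Sum>R | R \<subseteq> {..<d} \<and> card R = c.
               ?P R * (\<Sum>i\<in>{..<d} - R. \<Sum>j\<in>{..<d} - R - {i}. x i * (x i - x j)))"
    using nn by (intro sum_nonneg mult_nonneg_nonneg prod_nonneg sum_swap_diff_nonneg) auto
  also have "\<dots> = (\<Sum>R | R \<subseteq> {..<d} \<and> card R = c. \<Sum>i\<in>{..<d} - R.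
               \<Sum>j\<in>{..<d} - R - {i}. ?P R * x i * (x i - x j))"
    by (simp add: sum_distrib_left mult.assoc)
  \<comment> \<open>Put \<open>B = insert i R\<close>: then \<open>x i\<close> completes the product
    over \<open>R\<close> to the one over \<open>B\<close>, and \<open>j\<close> runs through the
    complement of \<open>B\<close>.\<close>
  also have "\<dots> = (\<Sum>B\<in>?F. \<Sum>i\<in>B. \<Sum>j\<in>{..<d} - (B - {i}) - {i}. ?P (B - {i}) * x i * (x i - x j))"
    using Suc by (subst sum_subset_insert) simp
  also have "\<dots> = (\<Sum>B\<in>?F. ?P B * (real (d - b) * (\<Sum>i<d. x i) - real d * (\<Sum>i\<in>{..<d} - B. x i)))"
  proof (intro sum.cong refl)
    fix B assume "B \<in> ?F"
    then have B: "B \<subseteq> {..<d}" "card B = b" "finite B"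
      using finite_subset by auto
    have cD: "card ({..<d} - B) = d - b"
      using B by (simp add: card_Diff_subset)
    have "(\<Sum>i\<in>B. \<Sum>j\<in>{..<d} - (B - {i}) - {i}. ?P (B - {i}) * x i * (x i - x j))
        = (\<Sum>i\<in>B. \<Sum>j\<in>{..<d} - B. ?P B * (x i - x j))"
    proof (intro sum.cong refl)
      fix i assume "i \<in> B"
      then show "{..<d} - (B - {i}) - {i} = {..<d} - B" by auto
      fix j
      show "?P (B - {i}) * x i * (x i - x j) = ?P B * (x i - x j)"
        using \<open>i \<in> B\<close> B by (simp add: prod.remove[of B i] mult.commute)
    qed
    also have "\<dots> = ?P B * (real (d - b) * sum x B - real b * sum x ({..<d} - B))"
      by (simp add: sum_distrib_left[symmetric] sum_subtractf cD B(2)) 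
    \<comment> \<open>The sum over \<open>B\<close> is traded for the sum over all indices, because
      \<open>?P B * x i\<close> summed over \<open>i\<close> outside \<open>B\<close> is what
      \<open>elem_sym_Suc\<close> evaluates.\<close>
    also have "real (d - b) * sum x B - real b * sum x ({..<d} - B)
        = real (d - b) * (\<Sum>i<d. x i) - real d * (\<Sum>i\<in>{..<d} - B. x i)"
      using B \<open>b < d\<close> by (simp add: sum.subset_diff[of B "{..<d}" x] of_nat_diff algebra_simps)
    finally show "(\<Sum>i\<in>B. \<Sum>j\<in>{..<d} - (B - {i}) - {i}. ?P (B - {i}) * x i * (x i - x j))
        = ?P B * (real (d - b) * (\<Sum>i<d. x i) - real d * (\<Sum>i\<in>{..<d} - B. x i))" .
  qed
  also have "\<dots> = real (d - b) * ((\<Sum>i<d. x i) * elem_sym d b x)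
      - real d * (real (Suc b) * elem_sym d (Suc b) x)"
    unfolding elem_sym_Suc[symmetric] 
    by (simp add: elem_sym_def right_diff_distrib sum_subtractf sum_distrib_left sum_distrib_right mult_ac)
  finally show ?thesis by simp
qed

text \<open>Dividing \<open>elem_sym_newton\<close> by
  \<open>(d - b) * (d choose b) = (b + 1) * (d choose (b + 1))\<close> turns it into a comparison of
  means: raising the degree by one multiplies the mean by at most \<open>e / d\<close>, where
  \<open>e\<close> is the sum of the \<open>x i\<close>.\<close>

lemma balanced_mean_Suc:
  assumes nn: "\<And>i. i < d \<Longrightarrow> 0 \<le> x i" and d: "d \<ge> 2"
  shows "real d * balanced_mean d (Suc k) x \<le> (\<Sum>i<d. x i) * balanced_mean d k x"
proof -
  define b where "b = k mod d"
  define s where "s = k div d"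
  define P where "P = (\<Prod>i<d. x i)"
  have b: "b < d" using d by (simp add: b_def)
  have P: "P \<ge> 0" unfolding P_def using nn by (intro prod_nonneg) auto
  \<comment> \<open>If \<open>Suc b = d\<close>, the remainder wraps round to 0 and the quotient
    goes up by one; \<open>elem_sym d d x = P\<close> supplies the extra factor, so one formula
    covers both cases.\<close>
  have M: "balanced_mean d (Suc k) x = P ^ s * (elem_sym d (Suc b) x / real (d choose Suc b))"
  proof (cases "Suc b = d")
    case True
    then have "Suc k mod d = 0" "Suc k div d = Suc s"
      by (auto simp: b_def s_def mod_Suc div_Suc)
    then show ?thesis 
      using True by (simp add: balanced_mean_def P_def elem_sym_full)
  next
    case False
    then have "Suc k mod d = Suc b" "Suc k div d = s"
      by (auto simp: b_def s_def mod_Suc div_Suc)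
    then show ?thesis by (simp add: balanced_mean_def P_def)
  qed
  have c: "real (d - b) * real (d choose b) = real (Suc b) * real (d choose Suc b)"
    using binomial_absorb_comp[of d b] binomial_absorption[of b d] b
    by (metis of_nat_mult)
  have pos: "real (d choose b) > 0" "real (d choose Suc b) > 0" "real (d - b) > 0"
    using b by auto
  have "real d * (elem_sym d (Suc b) x / real (d choose Suc b))
      \<le> (\<Sum>i<d. x i) * (elem_sym d b x / real (d choose b))"
  proof -
    have "real d * (elem_sym d (Suc b) x / real (d choose Suc b))
        = real d * (real (Suc b) * elem_sym d (Suc b) x) / (real (d - b) * real (d choose b))"
      unfolding c using pos by (simp del: of_nat_Suc add: mult.left_commute)
    also have "\<dots> \<le> real (d - b) * ((\<Sum>i<d. x i) * elem_sym d b x) / (real (d - b) * real (d choose b))"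
      using elem_sym_newton[OF nn b] pos by (intro divide_right_mono) auto
    finally show ?thesis using pos by simp
  qed
  then have "P ^ s * (real d * (elem_sym d (Suc b) x / real (d choose Suc b)))
      \<le> P ^ s * ((\<Sum>i<d. x i) * (elem_sym d b x / real (d choose b)))"
    using P by (intro mult_left_mono) auto
  then show ?thesis
    unfolding M by (simp add: balanced_mean_def P_def s_def b_def mult_ac)
qed

text \<open>For \<open>m = 1\<close> the difference of the two sides is
  \<open>(u - v) * (e - u - v)\<close>; the other \<open>m - 1\<close> powers preserve the
  order.\<close>

lemma power_mult_diff_mono:
  fixes u v e :: real
  assumes "0 \<le> v" "v \<le> u" "u + v \<le> e" "m \<ge> 1"
  shows "v ^ m * (e - v) \<le> u ^ m * (e - u)"
proof -
  obtain c where m: "m = Suc c" using assms(4) by (cases m) auto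
  have *: "v * (e - v) \<le> u * (e - u)"
  proof -
    have "0 \<le> (u - v) * (e - u - v)" using assms by (intro mult_nonneg_nonneg) auto
    then show ?thesis by (simp add: algebra_simps)
  qed
  have "v ^ c * (v * (e - v)) \<le> u ^ c * (u * (e - u))"
    by (rule mult_mono[OF power_mono *]) (use assms in auto)
  then show ?thesis by (simp only: m power_Suc2 mult.assoc)
qed

text \<open>Chebyshev's sum inequality for \<open>x i\<close> and
  \<open>x i ^ m * (e - x i)\<close>, which are ordered in the same way by
  \<open>power_mult_diff_mono\<close>.\<close>

lemma sum_power_mult_diff_Suc:
  fixes x :: "nat \<Rightarrow> real"
  assumes nn: "\<And>i. i < d \<Longrightarrow> 0 \<le> x i" and m: "m \<ge> 1"
  defines "e \<equiv> \<Sum>i<d. x i"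
  shows "e * (\<Sum>i<d. x i ^ m * (e - x i)) \<le> real d * (\<Sum>i<d. x i ^ Suc m * (e - x i))"
proof -
  define \<phi> where "\<phi> i = x i ^ m * (e - x i)" for i
  define S where "S = (\<Sum>i<d. \<Sum>j<d. (x i - x j) * \<phi> i)"
  have "S = (\<Sum>i<d. \<Sum>j<d. (x j - x i) * \<phi> j)"
    unfolding S_def by (rule sum.swap)
  then have "2 * S = S + (\<Sum>i<d. \<Sum>j<d. (x j - x i) * \<phi> j)"
    by simp
  also have "\<dots> = (\<Sum>i<d. \<Sum>j<d. (x i - x j) * (\<phi> i - \<phi> j))"
    unfolding S_def sum.distrib[symmetric] by (simp add: algebra_simps)
  also have "\<dots> \<ge> 0"
  proof (intro sum_nonneg)
    fix i j assume ij: "i \<in> {..<d}" "j \<in> {..<d}"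
    show "0 \<le> (x i - x j) * (\<phi> i - \<phi> j)"
    proof (cases "i = j")
      case False
      have "x i + x j = sum x {i, j}" using False by simp
      also have "\<dots> \<le> e" unfolding e_def using ij nn by (intro sum_mono2) auto
      finally have le: "x i + x j \<le> e" .
      show ?thesis
        using power_mult_diff_mono[of "x i" "x j" e m] power_mult_diff_mono[of "x j" "x i" e m] nn ij m le
        by (cases "x i \<le> x j") (auto simp: \<phi>_def zero_le_mult_iff add.commute)
    qed auto
  qed
  finally have "0 \<le> S" by simp
  also have "S = (\<Sum>i<d. real d * (x i * \<phi> i)) - (\<Sum>i<d. e * \<phi> i)"
    unfolding S_def e_def
    by (simp add: left_diff_distrib sum_subtractf sum_distrib_right[symmetric])
  also have "\<dots> = real d * (\<Sum>i<d. x i ^ Suc m * (e - x i)) - e * (\<Sum>i<d. \<phi> i)"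
    by (simp add: sum_distrib_left \<phi>_def mult.assoc)
  finally show ?thesis by (simp add: \<phi>_def)
qed

text \<open>Let \<open>e\<close> be the sum of the \<open>x i\<close>. From \<open>m\<close> to
  \<open>Suc m\<close> the left side grows by a factor of at most \<open>e / d\<close>
  (\<open>balanced_mean_Suc\<close>), the right side by at least \<open>e / d\<close>
  (\<open>sum_power_mult_diff_Suc\<close>). For \<open>m = 1\<close> both sides equal
  \<open>2 * elem_sym d 2 x\<close>.\<close>

lemma sum_power_mult_diff_ge:
  fixes x :: "nat \<Rightarrow> real"
  assumes nn: "\<And>i. i < d \<Longrightarrow> 0 \<le> x i" and d: "d \<ge> 2" and m: "m \<ge> 1"
  shows "real d * real (d - 1) * balanced_mean d (Suc m) x
      \<le> (\<Sum>i<d. x i ^ m * ((\<Sum>i<d. x i) - x i))"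
  using m
proof (induction m rule: dec_induct)
  case base
  define e where "e = (\<Sum>i<d. x i)"
  have "(\<Sum>R | R \<subseteq> {..<d} \<and> card R = 1. \<Sum>i\<in>{..<d} - R. (\<Prod>j\<in>R. x j) * x i)
      = (\<Sum>j<d. \<Sum>i\<in>{..<d} - {j}. x j * x i)"
    by (rule sum.reindex_bij_witness[where i="\<lambda>j. {j}" and j=the_elem])
      (auto simp: card_1_singleton_iff)
  also have "\<dots> = (\<Sum>j<d. x j * (e - x j))"
    by (intro sum.cong refl) (simp add: sum_distrib_left[symmetric] sum_diff1 e_def)
  finally have *: "2 * elem_sym d 2 x = (\<Sum>j<d. x j * (e - x j))"
    using elem_sym_Suc[where d=d and b=1 and x=x] by (simp add: numeral_2_eq_2)
  \<comment> \<open>\<open>d = 2\<close> stands apart because then \<open>2 mod d = 0\<close>, and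
    the mean is the full product, that is \<open>elem_sym 2 2 x\<close>.\<close>
  have "balanced_mean d 2 x = elem_sym d 2 x / real (d choose 2)"
  proof (cases "d = 2")
    case True
    then show ?thesis by (simp add: balanced_mean_def elem_sym_full)
  qed (use d in \<open>simp add: balanced_mean_def\<close>)
  moreover have "real d * real (d - 1) = 2 * real (d choose 2)"
  proof -
    have "d * (d - 1) = 2 * (d choose 2)"
      using binomial_absorption[of 1 d] by (simp add: numeral_2_eq_2)
    then show ?thesis by (metis of_nat_mult of_nat_numeral)
  qed
  moreover have "d choose 2 > 0" using d by simp
  ultimately have "real d * real (d - 1) * balanced_mean d 2 x = 2 * elem_sym d 2 x"
    by simp
  then show ?case using * by (simp add: e_def numeral_2_eq_2)
next
  case (step m)
  let ?e = "\<Sum>i<d. x i"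
  let ?T = "\<lambda>m. \<Sum>i<d. x i ^ m * (?e - x i)"
  have e: "?e \<ge> 0" using nn by (intro sum_nonneg) auto
  have "real d * (real d * real (d - 1) * balanced_mean d (Suc (Suc m)) x)
      \<le> real d * real (d - 1) * (?e * balanced_mean d (Suc m) x)"
    using mult_left_mono[OF balanced_mean_Suc[of d x "Suc m", OF nn d], of "real d * real (d - 1)"]
    by (simp add: mult_ac)
  also have "\<dots> \<le> ?e * ?T m"
    using mult_left_mono[OF step.IH e] by (simp add: mult_ac)
  also have "\<dots> \<le> real d * ?T (Suc m)"
    using sum_power_mult_diff_Suc[OF nn step.hyps(1)] by simp
  finally show ?case using d by (simp del: power_Suc)
qed

text \<open>With \<open>e\<close> the sum of the \<open>x i\<close>, the right side for
  \<open>Suc k\<close> is \<open>e\<close> times the one for \<open>k\<close> plus the sum of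
  \<open>x i ^ k * (e - x i)\<close>; likewise
  \<open>d ^ Suc k - d = d * (d ^ k - d) + d * (d - 1)\<close>. The induction hypothesis handles the
  first summand and \<open>sum_power_mult_diff_ge\<close> the second. Equality holds when all
  \<open>x i\<close> agree, which is why evenly spread trees attain the bound
  asymptotically.\<close>

lemma balanced_mean_le:
  fixes x :: "nat \<Rightarrow> real"
  assumes nn: "\<And>i. i < d \<Longrightarrow> 0 \<le> x i" and d: "d \<ge> 2" and k: "k \<ge> 1"
  shows "(real d ^ k - real d) * balanced_mean d k x \<le> (\<Sum>i<d. x i) ^ k - (\<Sum>i<d. x i ^ k)"
  using k
proof (induction k rule: dec_induct)
  case base
  then show ?case by simp
next
  case (step k)
  let ?e = "\<Sum>i<d. x i"
  have e: "?e \<ge> 0" using nn by (intro sum_nonneg) auto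
  have dk: "real d ^ k - real d \<ge> 0"
    using step.hyps d self_le_power[of "real d" k] by simp
  have "(real d ^ Suc k - real d) * balanced_mean d (Suc k) x
     = (real d ^ k - real d) * (real d * balanced_mean d (Suc k) x)
       + real d * real (d - 1) * balanced_mean d (Suc k) x"
    using d by (simp add: algebra_simps of_nat_diff)
  also have "\<dots> \<le> (real d ^ k - real d) * (?e * balanced_mean d k x)
      + (\<Sum>i<d. x i ^ k * (?e - x i))"
    using balanced_mean_Suc[OF nn d] sum_power_mult_diff_ge[OF nn d step.hyps(1)] dk
    by (intro add_mono mult_left_mono) auto
  also have "\<dots> \<le> ?e * (?e ^ k - (\<Sum>i<d. x i ^ k)) + (\<Sum>i<d. x i ^ k * (?e - x i))"
    using mult_left_mono[OF step.IH e] by (simp add: mult_ac)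
  also have "\<dots> = ?e ^ Suc k - (\<Sum>i<d. x i ^ Suc k)"
    by (simp add: right_diff_distrib sum_subtractf sum_distrib_left sum_distrib_right mult_ac)
  finally show ?case .
qed

section \<open>Isomorphism and induced trees\<close>

lemma root_in_vertices [simp]: "[] \<in> vertices T"
  by (cases T) auto

lemma Cons_in_vertices [simp]: "i # p \<in> vertices (Node ts) \<longleftrightarrow> i < length ts \<and> p \<in> vertices (ts ! i)"
  by auto

declare vertices.simps [simp del]

lemma vertices_append: "p @ q \<in> vertices T \<Longrightarrow> p \<in> vertices T"
proof (induction T arbitrary: p rule: vertices.induct)
  case (1 ts)
  then show ?case by (cases p) auto
qed

lemma child_of_Cons [simp]: "child_of (i # p) (j # q) \<longleftrightarrow> i = j \<and> child_of p q"
  by (auto simp: child_of_def)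

lemma child_of_Nil [simp]: "\<not> child_of [] p" "child_of p [] \<longleftrightarrow> (\<exists>i. p = [i])"
  by (auto simp: child_of_def)

lemma child_of_snoc: "child_of (p @ [i]) q \<longleftrightarrow> q = p"
  by (auto simp: child_of_def)

lemma Nil_in_leaves [simp]: "[] \<in> leaves (Node ts) \<longleftrightarrow> ts = []"
proof -
  have "[0] \<in> vertices (Node ts)" if "ts \<noteq> []" using that by simp
  moreover have "vertices (Node []) = {[]}" by (simp add: vertices.simps)
  ultimately show ?thesis unfolding leaves_def by (cases "ts = []") fastforce+
qed

lemma Cons_in_leaves [simp]:
  "i # p \<in> leaves (Node ts) \<longleftrightarrow> i < length ts \<and> p \<in> leaves (ts ! i)"
  by (auto simp: leaves_def child_of_def)

lemma leaves_Node:
  "leaves (Node ts) = (if ts = [] then {[]} else (\<Union>i<length ts. (#) i ` leaves (ts ! i)))"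
proof -
  have "p \<in> leaves (Node ts) \<longleftrightarrow>
      p \<in> (if ts = [] then {[]} else (\<Union>i<length ts. (#) i ` leaves (ts ! i)))" for p
    by (cases p) auto
  then show ?thesis by blast
qed

lemma finite_leaves [simp]: "finite (leaves T)"
proof (induction T rule: vertices.induct)
  case (1 ts)
  then show ?case by (auto simp: leaves_Node)
qed

lemma leaves_nonempty: "leaves T \<noteq> {}"
proof (induction T rule: vertices.induct)
  case (1 ts)
  show ?case
  proof (cases ts)
    case (Cons t us)
    then show ?thesis using 1[of 0] by (force simp: leaves_Node)
  qed (simp add: leaves_Node)
qed

lemma num_leaves_pos: "num_leaves T > 0"
  using leaves_nonempty finite_leaves by (simp add: num_leaves_def card_gt_0_iff)

lemma card_UN_Cons:
  assumes "finite I" "\<And>i. i \<in> I \<Longrightarrow> finite (A i)"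
  shows "card (\<Union>i\<in>I. (#) i ` A i) = (\<Sum>i\<in>I. card (A i))"
  using assms by (subst card_UN_disjoint) (auto simp: card_image)

lemma num_leaves_Node:
  "num_leaves (Node ts) = (if ts = [] then 1 else (\<Sum>i<length ts. num_leaves (ts ! i)))"
  by (simp add: num_leaves_def leaves_Node card_UN_Cons)

text \<open>Forgetting the order of the branches turns isomorphism into equality.\<close>

datatype mtree = MNode "mtree multiset"

fun canon :: "tree \<Rightarrow> mtree" where
  "canon (Node ts) = MNode (mset (map canon ts))"

primrec msize :: "mtree \<Rightarrow> nat" where
  "msize (MNode M) = (if M = {#} then 1 else sum_mset (image_mset msize M))"

lemma sum_list_nth: "sum_list (map f xs) = (\<Sum>i<length xs. f (xs ! i))"
  by (simp add: sum_list_sum_nth atLeast0LessThan)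

lemma msize_canon: "msize (canon T) = num_leaves T"
proof (induction T rule: vertices.induct)
  case (1 ts)
  have "msize (canon (Node ts)) = (if ts = [] then 1 else (\<Sum>i<length ts. msize (canon (ts ! i))))"
    by (simp add: multiset.map_comp comp_def sum_mset_sum_list flip: mset_map)
       (simp add: sum_list_nth)
  then show ?case using 1 by (simp add: num_leaves_Node del: canon.simps)
qed

lemma mset_nth: "mset (map f xs) = image_mset (\<lambda>i. f (xs ! i)) (mset_set {..<length xs})"
proof -
  have "mset (map f xs) = mset (map f (map ((!) xs) [0..<length xs]))"
    by (simp only: map_nth)
  then show ?thesis
    by (simp only: mset_map mset_upt atLeast0LessThan multiset.map_comp comp_def)
qed

text \<open>An isomorphism maps the children of the root bijectively, by \<open>\<pi>\<close>, and
  the subtree below child \<open>i\<close> onto the one below child \<open>\<pi> i\<close>;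
  restricted there it is again an isomorphism.\<close>

lemma isomorphic_imp_canon_eq: "isomorphic T U \<Longrightarrow> canon T = canon U"
proof (induction T arbitrary: U rule: vertices.induct)
  case (1 ts)
  obtain us where U: "U = Node us" by (cases U)
  obtain f where f: "bij_betw f (vertices (Node ts)) (vertices (Node us))" "f [] = []"
    and ch: "\<And>u v. u \<in> vertices (Node ts) \<Longrightarrow> v \<in> vertices (Node ts) \<Longrightarrow>
               child_of v u \<longleftrightarrow> child_of (f v) (f u)"
    using "1.prems" unfolding isomorphic_def U by blast
  have fin: "f v \<in> vertices (Node us)" if "v \<in> vertices (Node ts)" for v
    using f that by (auto simp: bij_betw_def)
  have inj: "f u = f v \<longleftrightarrow> u = v" if "u \<in> vertices (Node ts)" "v \<in> vertices (Node ts)" for u v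
    using f that by (auto simp: bij_betw_def inj_on_def)
  have surj: "\<exists>v \<in> vertices (Node ts). f v = w" if "w \<in> vertices (Node us)" for w
    using f that unfolding bij_betw_def by (metis imageE)
  define \<pi> where "\<pi> i = hd (f [i])" for i
  have f1: "f [i] = [\<pi> i] \<and> \<pi> i < length us" if "i < length ts" for i
  proof -
    have "child_of (f [i]) []" using ch[of "[]" "[i]"] that f by simp
    then obtain j where "f [i] = [j]" by auto
    then show ?thesis using fin[of "[i]"] that by (simp add: \<pi>_def)
  qed
  \<comment> \<open>Going down a path, the image of a child is a child of the image, so the first
    entry \<open>\<pi> i\<close> never changes.\<close>
  have sub: "\<exists>q. f (i # p) = \<pi> i # q" if "i < length ts" "p \<in> vertices (ts ! i)" for i p
    using that(2)
  proof (induction p rule: rev_induct)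
    case Nil
    then show ?case using f1 that by simp
  next
    case (snoc j p)
    then have p: "p \<in> vertices (ts ! i)" using vertices_append by blast
    then obtain q where q: "f (i # p) = \<pi> i # q" using snoc by blast
    have "child_of (f (i # p @ [j])) (f (i # p))"
      using ch[of "i # p" "i # p @ [j]"] snoc.prems p that by (simp add: child_of_snoc)
    then show ?case unfolding q by (auto simp: child_of_def)
  qed
  have bij: "bij_betw \<pi> {..<length ts} {..<length us}"
    unfolding bij_betw_def
  proof (intro conjI set_eqI iffI)
    show "inj_on \<pi> {..<length ts}"
    proof (rule inj_onI)
      fix i j assume "i \<in> {..<length ts}" "j \<in> {..<length ts}" "\<pi> i = \<pi> j"
      then show "i = j" using f1[of i] f1[of j] inj[of "[i]" "[j]"] by simp
    qed
  next
    fix j assume "j \<in> {..<length us}"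
    then obtain v where v: "v \<in> vertices (Node ts)" "f v = [j]" using surj[of "[j]"] by auto
    then have "child_of v []" using ch[of "[]" v] f by simp
    then show "j \<in> \<pi> ` {..<length ts}" using v f1 by force
  qed (use f1 in auto)
  have iso: "isomorphic (ts ! i) (us ! \<pi> i)" if i: "i < length ts" for i
    unfolding isomorphic_def
  proof (intro exI conjI ballI)
    let ?g = "\<lambda>p. tl (f (i # p))"
    have g: "f (i # p) = \<pi> i # ?g p" if "p \<in> vertices (ts ! i)" for p
      using sub[OF i that] by auto
    have tov: "i # p \<in> vertices (Node ts)" if "p \<in> vertices (ts ! i)" for p
      using that i by simp
    show "?g [] = []" using f1[OF i] by simp
    show "bij_betw ?g (vertices (ts ! i)) (vertices (us ! \<pi> i))"
      unfolding bij_betw_def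
    proof (intro conjI set_eqI iffI)
      show "inj_on ?g (vertices (ts ! i))"
      proof (rule inj_onI)
        fix p q assume pq: "p \<in> vertices (ts ! i)" "q \<in> vertices (ts ! i)" "?g p = ?g q"
        then have "f (i # p) = f (i # q)" using g by metis
        then show "p = q" using inj[OF tov tov] pq by simp
      qed
    next
      fix q assume "q \<in> ?g ` vertices (ts ! i)"
      then obtain p where p: "p \<in> vertices (ts ! i)" "q = ?g p" by blast
      then show "q \<in> vertices (us ! \<pi> i)" using fin[OF tov[OF p(1)]] g[OF p(1)]
        by (metis Cons_in_vertices)
    next
      fix q assume "q \<in> vertices (us ! \<pi> i)"
      then obtain v where v: "v \<in> vertices (Node ts)" "f v = \<pi> i # q"
        using surj[of "\<pi> i # q"] f1[OF i] by auto
      then obtain j p where jp: "v = j # p" "j < length ts" "p \<in> vertices (ts ! j)"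
        using f by (cases v) auto
      then have "\<pi> j = \<pi> i" using sub[of j p] v by auto
      then have "j = i" using bij i jp by (auto simp: bij_betw_def inj_on_def)
      then show "q \<in> ?g ` vertices (ts ! i)" using jp v by force
    qed
    fix p q assume pq: "p \<in> vertices (ts ! i)" "q \<in> vertices (ts ! i)"
    then show "child_of q p \<longleftrightarrow> child_of (?g q) (?g p)"
      using ch[OF tov[OF pq(1)] tov[OF pq(2)]] g[OF pq(1)] g[OF pq(2)]
      by (metis child_of_Cons)
  qed
  have "mset (map canon ts) = image_mset (\<lambda>i. canon (us ! \<pi> i)) (mset_set {..<length ts})"
    unfolding mset_nth using 1(1) iso by (intro image_mset_cong) auto
  also have "\<dots> = image_mset (\<lambda>i. canon (us ! i)) (image_mset \<pi> (mset_set {..<length ts}))"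
    by (simp add: multiset.map_comp comp_def)
  also have "image_mset \<pi> (mset_set {..<length ts}) = mset_set {..<length us}"
    using bij by (simp add: bij_betw_def image_mset_mset_set)
  finally show ?case by (simp add: U mset_nth[symmetric])
qed

text \<open>Equal multisets of branches differ by a permutation \<open>\<pi>\<close>. The
  isomorphisms between matched branches are glued to a map that rewrites the first entry of an
  address by \<open>\<pi>\<close>.\<close>

lemma canon_eq_imp_isomorphic: "canon T = canon U \<Longrightarrow> isomorphic T U"
proof (induction T arbitrary: U rule: vertices.induct)
  case (1 ts)
  obtain us where U: "U = Node us" by (cases U)
  have m: "mset (map canon ts) = mset (map canon us)" using "1.prems" by (simp add: U)
  then have len: "length ts = length us" by (metis length_map size_mset)
  obtain \<pi> where \<pi>: "\<pi> permutes {..<length us}" "permute_list \<pi> (map canon us) = map canon ts"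
    using mset_eq_permutation[OF m] by auto
  have \<pi>_less: "\<pi> i < length us \<longleftrightarrow> i < length us" for i
    using permutes_in_image[OF \<pi>(1)] by simp
  have "canon (ts ! i) = canon (us ! \<pi> i)" if "i < length ts" for i
    using \<pi> that len by (metis length_map nth_map permute_list_nth \<pi>_less)
  then have "\<forall>i<length ts. isomorphic (ts ! i) (us ! \<pi> i)"
    using 1(1) by auto
  then obtain g where g: "\<And>i. i < length ts \<Longrightarrow> bij_betw (g i) (vertices (ts ! i)) (vertices (us ! \<pi> i))"
    "\<And>i. i < length ts \<Longrightarrow> g i [] = []"
    and ch: "\<And>i u v. i < length ts \<Longrightarrow> u \<in> vertices (ts ! i) \<Longrightarrow> v \<in> vertices (ts ! i) \<Longrightarrow>
        child_of v u \<longleftrightarrow> child_of (g i v) (g i u)"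
    unfolding isomorphic_def by metis
  define f where "f p = (case p of [] \<Rightarrow> [] | i # q \<Rightarrow> \<pi> i # g i q)" for p
  have f_simps [simp]: "f [] = []" "f (i # q) = \<pi> i # g i q" for i q
    by (simp_all add: f_def)
  have \<pi>_eq: "\<pi> i = \<pi> j \<longleftrightarrow> i = j" for i j
    using permutes_inj[OF \<pi>(1)] by (auto simp: inj_def)
  show ?case
    unfolding isomorphic_def U
  proof (intro exI conjI ballI)
    show "bij_betw f (vertices (Node ts)) (vertices (Node us))"
      unfolding bij_betw_def
    proof (intro conjI set_eqI iffI)
      show "inj_on f (vertices (Node ts))"
      proof (rule inj_onI)
        fix p q assume "p \<in> vertices (Node ts)" "q \<in> vertices (Node ts)" "f p = f q"
        then show "p = q"
          using g(1) by (cases p; cases q) (auto simp: \<pi>_eq bij_betw_def inj_on_def)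
      qed
    next
      fix w assume "w \<in> f ` vertices (Node ts)"
      then obtain v where "v \<in> vertices (Node ts)" "w = f v" by blast
      then show "w \<in> vertices (Node us)"
        using g(1) len \<pi>_less by (cases v) (auto simp: bij_betw_def)
    next
      fix w assume w: "w \<in> vertices (Node us)"
      show "w \<in> f ` vertices (Node ts)"
      proof (cases w)
        case Nil
        then show ?thesis by (metis f_simps(1) imageI root_in_vertices)
      next
        case (Cons j q)
        define i where "i = inv \<pi> j"
        have i: "\<pi> i = j" by (simp add: i_def permutes_inverses[OF \<pi>(1)])
        then have il: "i < length ts" using w Cons \<pi>_less[of i] len by simp
        moreover have "q \<in> g i ` vertices (ts ! i)"
          using g(1)[OF il] w Cons i by (auto simp: bij_betw_def)
        ultimately obtain p where "p \<in> vertices (ts ! i)" "q = g i p" by blast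
        then have "i # p \<in> vertices (Node ts)" "w = f (i # p)" using il Cons i by simp_all
        then show ?thesis by blast
      qed
    qed
    fix u v assume uv: "u \<in> vertices (Node ts)" "v \<in> vertices (Node ts)"
    \<comment> \<open>Needed for the children of the root: \<open>[i]\<close> must go to an address
      of length one, and nothing else in branch \<open>i\<close> may.\<close>
    have g_Nil: "g i p = [] \<longleftrightarrow> p = []" if "i < length ts" "p \<in> vertices (ts ! i)" for i p
      using g[OF that(1)] that(2) inj_onD[of "g i" "vertices (ts ! i)" p "[]"]
      by (auto simp: bij_betw_def)
    show "child_of v u \<longleftrightarrow> child_of (f v) (f u)"
      using uv ch g_Nil by (cases u; cases v) (auto simp: \<pi>_eq)
  qed simp
qed

lemma isomorphic_iff_canon: "isomorphic T U \<longleftrightarrow> canon T = canon U"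
  using isomorphic_imp_canon_eq canon_eq_imp_isomorphic by blast

section \<open>Traces of a leaf set on the branches, and the tree it induces\<close>

definition branch :: "nat list set \<Rightarrow> nat \<Rightarrow> nat list set" where
  "branch S i = {p. i # p \<in> S}"

lemma branch_subset_leaves:
  "S \<subseteq> leaves (Node ts) \<Longrightarrow> i < length ts \<Longrightarrow> branch S i \<subseteq> leaves (ts ! i)"
  by (auto simp: branch_def subset_iff)

lemma branch_empty:
  "S \<subseteq> leaves (Node ts) \<Longrightarrow> length ts \<le> i \<Longrightarrow> branch S i = {}"
  by (fastforce simp: branch_def subset_iff)

lemma branch_Cons_image [simp]: "branch ((#) i ` S) j = (if i = j then S else {})"
  by (auto simp: branch_def)

lemma branch_UN_Cons [simp]: "branch (\<Union>i\<in>I. (#) i ` f i) j = (if j \<in> I then f j else {})"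
  by (auto simp: branch_def)

lemma UN_Cons_branch:
  assumes "S \<subseteq> leaves (Node ts)" "ts \<noteq> []" "length ts \<le> d"
  shows "(\<Union>i<d. (#) i ` branch S i) = S"
proof (intro equalityI subsetI)
  fix p assume p: "p \<in> S"
  then obtain i q where "p = i # q" using assms(1,2) by (cases p) auto
  then show "p \<in> (\<Union>i<d. (#) i ` branch S i)"
    using p assms(1,3) by (intro UN_I[of i]) (auto simp: branch_def)
qed (auto simp: branch_def)

lemma finite_branch: "S \<subseteq> leaves (Node ts) \<Longrightarrow> finite (branch S i)"
  by (cases "i < length ts")
     (auto simp: branch_empty intro: finite_subset[OF branch_subset_leaves])

lemma card_eq_sum_branch:
  assumes "S \<subseteq> leaves (Node ts)" "ts \<noteq> []" "length ts \<le> d"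
  shows "card S = (\<Sum>i<d. card (branch S i))"
  by (subst UN_Cons_branch[OF assms, symmetric], subst card_UN_Cons)
     (use finite_branch[OF assms(1)] in auto)

lemma suppress_Node: "length ts \<noteq> 1 \<Longrightarrow> suppress (Node ts) = Node (map suppress ts)"
  by (induction "Node ts" rule: suppress.induct) auto

lemma induced_leaf [simp]: "induced S (Node []) = Node []"
  by (simp add: induced_def)

text \<open>The pruned root has a single child, so \<open>suppress\<close> skips it.\<close>

lemma induced_single_branch:
  assumes "S \<subseteq> leaves (Node ts)" "i < length ts" "branch S i \<noteq> {}" "\<And>j. j \<noteq> i \<Longrightarrow> branch S j = {}"
  shows "induced S (Node ts) = induced (branch S i) (ts ! i)"
proof -
  have "(\<exists>p. j # p \<in> S) \<longleftrightarrow> j = i" for j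
    using assms(3,4) by (auto simp: branch_def)
  moreover have "filter (\<lambda>j. j = i) [0..<n] = [i]" if "i < n" for n
    using that by (induction n) (auto simp: less_Suc_eq filter_empty_conv)
  ultimately have "filter (\<lambda>i. \<exists>p. i # p \<in> S) [0..<length ts] = [i]"
    using assms(2) by simp
  then show ?thesis by (simp add: induced_def branch_def)
qed

text \<open>The pruned root has no child or at least two, so \<open>suppress\<close> keeps
  it.\<close>

lemma canon_induced_branching:
  assumes "card {i. i < length ts \<and> branch S i \<noteq> {}} \<noteq> 1"
  shows "canon (induced S (Node ts)) =
    MNode (image_mset (\<lambda>i. canon (induced (branch S i) (ts ! i)))
      (mset_set {i. i < length ts \<and> branch S i \<noteq> {}}))"
proof -
  define I where "I = filter (\<lambda>i. \<exists>p. i # p \<in> S) [0..<length ts]"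
  have set_I: "set I = {i. i < length ts \<and> branch S i \<noteq> {}}"
    by (auto simp: I_def branch_def)
  have "distinct I" by (simp add: I_def)
  then have "length I \<noteq> 1" "mset I = mset_set {i. i < length ts \<and> branch S i \<noteq> {}}"
    using assms set_I by (auto simp: distinct_card[symmetric] mset_set_set[symmetric])
  moreover have "induced S (Node ts) = suppress (Node (map (\<lambda>i. prune (branch S i) (ts ! i)) I))"
    by (simp add: induced_def I_def branch_def)
  ultimately show ?thesis
    by (simp add: suppress_Node induced_def comp_def)
qed

text \<open>In the first case the most recent common ancestor lies inside one branch, in the second
  it is the root. The counting recursion splits in this way.\<close>

lemma leaf_set_cases:
  assumes "S \<subseteq> leaves (Node ts)" "ts \<noteq> []" "S \<noteq> {}"
  obtains (single) i where "i < length ts" "branch S i \<noteq> {}" "\<And>j. j \<noteq> i \<Longrightarrow> branch S j = {}"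
  | (branching) "card {i. i < length ts \<and> branch S i \<noteq> {}} \<ge> 2"
proof -
  let ?I = "{i. i < length ts \<and> branch S i \<noteq> {}}"
  have "?I \<noteq> {}"
    using assms UN_Cons_branch[of S ts "length ts"] by fastforce
  then have "card ?I \<noteq> 0" by simp
  then consider "card ?I = 1" | "card ?I \<ge> 2" by linarith
  then show ?thesis
  proof cases
    case 1
    then obtain i where i: "?I = {i}" by (metis card_1_singletonE)
    show ?thesis
    proof (rule single)
      show "i < length ts" "branch S i \<noteq> {}" using i by blast+
      fix j assume "j \<noteq> i"
      then have "j \<notin> ?I" unfolding i by simp
      then show "branch S j = {}" using branch_empty[OF assms(1), of j] by force
    qed
  qed (rule branching)
qed

text \<open>Lets the size of a trace be read off from the tree it induces. The empty set is excluded
  because it induces a single vertex, which has one leaf.\<close>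

lemma msize_induced:
  "S \<subseteq> leaves T \<Longrightarrow> S \<noteq> {} \<Longrightarrow> msize (canon (induced S T)) = card S"
proof (induction T arbitrary: S rule: vertices.induct)
  case (1 ts)
  show ?case
  proof (cases "ts = []")
    case True
    then have "S = {[]}" using 1 by (auto simp: leaves_Node)
    then show ?thesis using True by simp
  next
    case False
    note c = card_eq_sum_branch[OF "1.prems"(1) False order_refl]
    have IH: "msize (canon (induced (branch S i) (ts ! i))) = card (branch S i)"
      if "i < length ts" "branch S i \<noteq> {}" for i
      using "1.IH" that branch_subset_leaves[OF "1.prems"(1)] by auto
    show ?thesis
      using "1.prems"(1) False "1.prems"(2)
    proof (cases rule: leaf_set_cases)
      case (single i)
      then have "card S = card (branch S i)"
        unfolding c by (subst sum.remove[of _ i]) auto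
      then show ?thesis using IH[OF single(1,2)] induced_single_branch[OF "1.prems"(1) single] by simp
    next
      case branching
      let ?I = "{i. i < length ts \<and> branch S i \<noteq> {}}"
      have "?I \<noteq> {}" using branching by force
      then have "msize (canon (induced S (Node ts))) = (\<Sum>i\<in>?I. msize (canon (induced (branch S i) (ts ! i))))"
        using branching by (subst canon_induced_branching) (auto simp: mset_set_empty_iff multiset.map_comp comp_def sum_unfold_sum_mset)
      also have "\<dots> = (\<Sum>i\<in>?I. card (branch S i))"
        using IH by (intro sum.cong) auto
      also have "\<dots> = card S" unfolding c by (rule sum.mono_neutral_left) auto
      finally show ?thesis .
    qed
  qed
qed

section \<open>Counting leaf sets that induce even trees\<close>

lemma canon_even_tree_le_1: "k \<le> 1 \<Longrightarrow> canon (even_tree d k) = MNode {#}"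
  by (simp add: even_tree.simps)

lemma canon_even_tree_le:
  assumes "d \<ge> 2" "2 \<le> k" "k \<le> d"
  shows "canon (even_tree d k) = MNode (replicate_mset k (MNode {#}))"
  using assms by (simp add: even_tree.simps[of d k])

lemma canon_even_tree_gt:
  assumes "d \<ge> 2" "k > d"
  shows "canon (even_tree d k) =
    MNode (replicate_mset (d - k mod d) (canon (even_tree d (k div d))) +
           replicate_mset (k mod d) (canon (even_tree d (k div d + 1))))"
  using assms by (simp add: even_tree.simps[of d k] flip: mset_replicate)

lemma div_Suc_less:
  fixes d k :: nat
  assumes "d \<ge> 2" "k > d"
  shows "k div d + 1 < k"
proof -
  have "k div d \<le> k div 2" using assms by (intro div_le_mono2) auto
  then show ?thesis using assms by auto
qed

lemma num_leaves_even_tree: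
  assumes "d \<ge> 2" "k \<ge> 1"
  shows "num_leaves (even_tree d k) = k"
  using assms(2)
proof (induction k rule: less_induct)
  case (less k)
  consider "k = 1" | "2 \<le> k" "k \<le> d" | "k > d" using less.prems by linarith
  then show ?case
  proof cases
    case 1
    then show ?thesis by (simp add: canon_even_tree_le_1 flip: msize_canon)
  next
    case 2
    then show ?thesis using assms(1) by (simp add: canon_even_tree_le flip: msize_canon)
  next
    case 3
    have "k div d \<ge> 1" using 3 assms by (simp add: div_greater_zero_iff Suc_le_eq)
    then have "num_leaves (even_tree d (k div d)) = k div d"
      "num_leaves (even_tree d (k div d + 1)) = k div d + 1"
      using less.IH[of "k div d"] less.IH[of "k div d + 1"] div_Suc_less[OF assms(1) 3] by auto
    then have "num_leaves (even_tree d k) = (d - k mod d) * (k div d) + (k mod d) * (k div d + 1)"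
      using assms(1) 3 by (simp add: canon_even_tree_gt flip: msize_canon)
    also have "\<dots> = d * (k div d) + k mod d"
    proof -
      have "k mod d \<le> d" using assms by (simp add: less_imp_le)
      then have "(d - k mod d) * (k div d) + (k mod d) * (k div d) = d * (k div d)"
        by (simp flip: add_mult_distrib)
      then show ?thesis unfolding add_mult_distrib2 by linarith
    qed
    finally show ?thesis by simp
  qed
qed

text \<open>For \<open>k = 0\<close> the empty leaf set counts by convention. A branch missed by a
  leaf set thus carries a copy of size 0, and the stars with \<open>k < d\<close> obey the same
  recursion as larger even trees, with \<open>k div d = 0\<close>.\<close>

definition even_sets :: "nat \<Rightarrow> nat \<Rightarrow> tree \<Rightarrow> nat list set set" where
  "even_sets d k T = {S. S \<subseteq> leaves T \<and> card S = k \<and>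
     (k = 0 \<or> canon (induced S T) = canon (even_tree d k))}"

text \<open>A root with fewer than \<open>d\<close> branches is padded with empty branches, whose only leaf set is
  the empty one.\<close>

definition branch_sets :: "nat \<Rightarrow> nat \<Rightarrow> tree list \<Rightarrow> nat \<Rightarrow> nat list set set" where
  "branch_sets d k ts i =
     (if i < length ts then even_sets d k (ts ! i) else if k = 0 then {{}} else {})"

lemma copies_even_tree:
  assumes "d \<ge> 2" "k \<ge> 1"
  shows "copies (even_tree d k) T = card (even_sets d k T)"
  using assms by (simp add: copies_def even_sets_def num_leaves_even_tree isomorphic_iff_canon)

lemma finite_even_sets [simp]: "finite (even_sets d k T)"
  by (rule finite_subset[of _ "Pow (leaves T)"]) (auto simp: even_sets_def)

lemma finite_branch_sets [simp]: "finite (branch_sets d k ts i)"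
  by (simp add: branch_sets_def)

lemma even_sets_0: "even_sets d 0 T = {{}}"
  by (auto simp: even_sets_def dest: finite_subset)

lemma branch_sets_card: "S \<in> branch_sets d k ts i \<Longrightarrow> card S = k \<and> finite S"
  by (auto simp: branch_sets_def even_sets_def card_eq_0_iff intro: finite_subset split: if_splits)

section \<open>The recursion at the root\<close>

lemma sum_of_bool:
  assumes "B \<subseteq> {..<d}"
  shows "(\<Sum>i<d. s + of_bool (i \<in> B)) = d * s + card B"
  using assms by (simp add: sum.distrib of_bool_def sum.If_cases Int_absorb1)

lemma card_larger_parts:
  assumes "d > 0" "(\<Sum>i<d. c i) = k" "\<And>i. i < d \<Longrightarrow> c i \<in> {k div d, k div d + 1}"
  shows "card {i. i < d \<and> c i = k div d + 1} = k mod d"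
proof -
  let ?B = "{i. i < d \<and> c i = k div d + 1}"
  have "k = (\<Sum>i<d. c i)" by (simp add: assms(2))
  also have "\<dots> = (\<Sum>i<d. k div d + of_bool (i \<in> ?B))"
    using assms(3) by (intro sum.cong) force+
  also have "\<dots> = d * (k div d) + card ?B"
    by (rule sum_of_bool) auto
  finally show ?thesis
    by (metis add_left_cancel mult_div_mod_eq)
qed

text \<open>The branches of the induced tree are compared with those of \<open>even_tree d k\<close>
  as multisets. \<open>msize_induced\<close> recovers the sizes of the traces, and
  \<open>card_larger_parts\<close> tells how often the larger size occurs. An empty trace is
  admissible only if \<open>k div d = 0\<close>.\<close>

lemma even_sets_branching_iff:
  assumes d: "d \<ge> 2" and k: "k \<ge> 2" and ts: "ts \<noteq> []" "length ts \<le> d"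
    and S: "S \<subseteq> leaves (Node ts)" "card S = k"
    and br: "card {i. i < length ts \<and> branch S i \<noteq> {}} \<ge> 2"
  shows "S \<in> even_sets d k (Node ts) \<longleftrightarrow>
    (\<forall>i<d. card (branch S i) \<in> {k div d, k div d + 1} \<and>
           branch S i \<in> branch_sets d (card (branch S i)) ts i)" (is "?L \<longleftrightarrow> ?R")
proof -
  define I where "I = {i. i < length ts \<and> branch S i \<noteq> {}}"
  define c where "c i = card (branch S i)" for i
  define G where "G i = canon (induced (branch S i) (ts ! i))" for i
  have fin: "finite (branch S i)" for i using finite_branch[OF S(1)] .
  have Id: "I \<subseteq> {..<d}" "finite I" using ts by (auto simp: I_def)
  have I_iff: "i \<in> I \<longleftrightarrow> c i \<noteq> 0" for i
    using fin[of i] branch_empty[OF S(1), of i] by (cases "i < length ts") (auto simp: I_def c_def)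
  have sum_c: "(\<Sum>i<d. c i) = k" "(\<Sum>i\<in>I. c i) = k"
  proof -
    show "(\<Sum>i<d. c i) = k"
      unfolding c_def using card_eq_sum_branch[OF S(1) ts] S(2) by simp
    moreover have "(\<Sum>i\<in>I. c i) = (\<Sum>i<d. c i)"
      using I_iff Id by (intro sum.mono_neutral_left) auto
    ultimately show "(\<Sum>i\<in>I. c i) = k" by simp
  qed
  have bs: "branch S i \<in> branch_sets d (c i) ts i \<longleftrightarrow> (i \<in> I \<longrightarrow> G i = canon (even_tree d (c i)))" for i
    using fin[of i] branch_subset_leaves[OF S(1), of i] branch_empty[OF S(1), of i]
    by (auto simp: branch_sets_def even_sets_def I_iff c_def[symmetric] G_def) (auto simp: I_def c_def)
  have G: "msize (G i) = c i" if "i \<in> I" for i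
    using that branch_subset_leaves[OF S(1)] by (simp add: G_def c_def I_def msize_induced)
  have L: "?L \<longleftrightarrow> MNode (image_mset G (mset_set I)) = canon (even_tree d k)"
    using S k br canon_induced_branching[of ts S] by (simp add: even_sets_def I_def G_def[abs_def])
  have "?L \<longleftrightarrow> (\<forall>i<d. c i \<in> {k div d, k div d + 1} \<and> (i \<in> I \<longrightarrow> G i = canon (even_tree d (c i))))"
    (is "_ \<longleftrightarrow> ?R'")
  proof (cases "k > d")
    case True
    then have s: "k div d \<ge> 1" using d by (simp add: div_greater_zero_iff Suc_le_eq)
    let ?M = "replicate_mset (d - k mod d) (canon (even_tree d (k div d))) +
           replicate_mset (k mod d) (canon (even_tree d (k div d + 1)))"
    \<comment> \<open>\<open>?M\<close> has \<open>d\<close> elements, so a leaf set whose induced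
      tree has these branches must meet \<open>d\<close> branches.\<close>
    have sz: "size ?M = d" using d by (simp add: less_imp_le)
    have "image_mset G (mset_set I) = ?M \<longleftrightarrow> ?R'"
    proof
      assume eq: "image_mset G (mset_set I) = ?M"
      then have "card I = d" using sz by (metis size_image_mset size_mset_set)
      then have I: "I = {..<d}" using Id by (intro card_subset_eq) auto
      show ?R'
      proof (intro allI impI)
        fix i assume i: "i < d"
        then have "G i \<in># image_mset G (mset_set I)" using I by simp
        then have "G i = canon (even_tree d (k div d)) \<or> G i = canon (even_tree d (k div d + 1))"
          unfolding eq by (auto split: if_splits simp: in_replicate_mset)
        moreover from this have "c i = k div d \<or> c i = k div d + 1"
          using G[of i] i I s d by (auto simp: msize_canon num_leaves_even_tree)
        ultimately show "c i \<in> {k div d, k div d + 1} \<and> (i \<in> I \<longrightarrow> G i = canon (even_tree d (c i)))"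
          using G[of i] i I s d by (auto simp: msize_canon num_leaves_even_tree)
      qed
    next
      assume R: ?R'
      \<comment> \<open>All sizes are at least \<open>k div d\<close>, which is positive here, so no
        trace is empty.\<close>
      then have I: "I = {..<d}" using Id I_iff s by force
      let ?B = "{i. i < d \<and> c i = k div d + 1}"
      have cB: "card ?B = k mod d"
        using card_larger_parts[of d c k] sum_c R d by auto
      have "mset_set I = mset_set (({..<d} - ?B) \<union> ?B)"
        unfolding I by (rule arg_cong[where f=mset_set]) auto
      also have "\<dots> = mset_set ({..<d} - ?B) + mset_set ?B"
        by (rule mset_set_Union) auto
      finally have "image_mset G (mset_set I) =
          image_mset G (mset_set ({..<d} - ?B)) + image_mset G (mset_set ?B)" by simp
      also have "image_mset G (mset_set ({..<d} - ?B)) =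
          image_mset (\<lambda>_. canon (even_tree d (k div d))) (mset_set ({..<d} - ?B))"
        using R I by (intro image_mset_cong) force
      also have "image_mset G (mset_set ?B) =
          image_mset (\<lambda>_. canon (even_tree d (k div d + 1))) (mset_set ?B)"
        using R I by (intro image_mset_cong) force
      finally show "image_mset G (mset_set I) = ?M"
        using cB by (simp add: image_mset_const_eq card_Diff_subset subset_eq)
    qed
    then show ?thesis unfolding L using canon_even_tree_gt[OF d True] by simp
  next
    case False
    \<comment> \<open>The star. For \<open>k < d\<close> the sizes are 0 and 1; for
      \<open>k = d\<close> they are 1 and, formally, 2, but the remainder 0 rules out the
      latter.\<close>
    have kd: "k div d + 1 = 1 \<and> k < d \<or> k = d \<and> k div d = 1 \<and> k mod d = 0"
      using False d by (cases "k = d") auto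
    have "image_mset G (mset_set I) = replicate_mset k (MNode {#}) \<longleftrightarrow> ?R'"
    proof
      assume eq: "image_mset G (mset_set I) = replicate_mset k (MNode {#})"
      then have cI: "card I = k" by (metis size_image_mset size_mset_set size_replicate_mset)
      have Gi: "G i = MNode {#}" if "i \<in> I" for i
      proof -
        have "G i \<in># image_mset G (mset_set I)" using that Id by simp
        then show ?thesis unfolding eq by (simp split: if_splits)
      qed
      then have c1: "c i = 1" if "i \<in> I" for i using G[OF that] Gi[OF that] by simp
      have Ik: "I = {..<d}" if "k = d" using cI Id that by (intro card_subset_eq) auto
      show ?R'
      proof (intro allI impI)
        fix i assume i: "i < d"
        have "i \<in> I \<Longrightarrow> G i = canon (even_tree d (c i))"
          using c1[of i] Gi[of i] by (simp add: canon_even_tree_le_1)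
        moreover have "c i \<in> {k div d, k div d + 1}"
          using kd
        proof
          assume "k div d + 1 = 1 \<and> k < d"
          then show ?thesis using c1[of i] I_iff[of i] by (cases "i \<in> I") auto
        next
          assume "k = d \<and> k div d = 1 \<and> k mod d = 0"
          then show ?thesis using c1[of i] Ik i by simp
        qed
        ultimately show "c i \<in> {k div d, k div d + 1} \<and> (i \<in> I \<longrightarrow> G i = canon (even_tree d (c i)))"
          by blast
      qed
    next
      assume R: ?R'
      have c1: "c i = 1" if "i \<in> I" for i
        using kd
      proof
        assume "k div d + 1 = 1 \<and> k < d"
        then show ?thesis using R that I_iff[of i] Id(1) by auto
      next
        assume kd: "k = d \<and> k div d = 1 \<and> k mod d = 0"
        then have "card {i. i < d \<and> c i = k div d + 1} = 0"
          using card_larger_parts[of d c k] sum_c(1) R d by auto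
        then have "{i. i < d \<and> c i = k div d + 1} = {}" by simp
        moreover have "i < d" using that Id(1) by auto
        ultimately show ?thesis using R kd by (metis (mono_tags, lifting) empty_Collect_eq insert_iff singletonD)
      qed
      then have "card I = k" using sum_c by simp
      have "image_mset G (mset_set I) = image_mset (\<lambda>_. MNode {#}) (mset_set I)"
        using R c1 Id by (intro image_mset_cong) (auto simp: canon_even_tree_le_1 subset_iff)
      then show "image_mset G (mset_set I) = replicate_mset k (MNode {#})"
        using \<open>card I = k\<close> by (simp add: image_mset_const_eq)
    qed
    then show ?thesis unfolding L using canon_even_tree_le[of d k] d k False by simp
  qed
  moreover have "branch S i \<in> branch_sets d (card (branch S i)) ts i \<longleftrightarrow>
      (i \<in> I \<longrightarrow> G i = canon (even_tree d (card (branch S i))))" for i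
    using bs[of i] by (simp only: c_def)
  ultimately show ?thesis by (simp only: c_def)
qed

text \<open>A leaf set counted here lies in one branch, or it branches at the root. In the latter
  case it is determined by its traces, which can be chosen independently once the set
  \<open>B\<close> of branches with the larger size is fixed.\<close>

lemma card_even_sets_Node:
  assumes d: "d \<ge> 2" and k: "k \<ge> 2" and ts: "ts \<noteq> []" "length ts \<le> d"
  shows "card (even_sets d k (Node ts)) = (\<Sum>i<length ts. card (even_sets d k (ts ! i))) +
    (\<Sum>B | B \<subseteq> {..<d} \<and> card B = k mod d.
       \<Prod>i<d. card (branch_sets d (k div d + of_bool (i \<in> B)) ts i))"
proof -
  define branching where "branching S \<longleftrightarrow> card {i. i < length ts \<and> branch S i \<noteq> {}} \<ge> 2" for S
  define A where "A i = (`) ((#) i) ` even_sets d k (ts ! i)" for i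
  define C where "C = {S \<in> even_sets d k (Node ts). branching S}"
  define P where "P B = (\<Pi>\<^sub>E i\<in>{..<d}. branch_sets d (k div d + of_bool (i \<in> B)) ts i)" for B
  define BB where "BB = {B. B \<subseteq> {..<d} \<and> card B = k mod d}"
  have A_char: "S \<in> A i \<longleftrightarrow> S \<in> even_sets d k (Node ts) \<and> branch S i \<noteq> {} \<and> (\<forall>j. j \<noteq> i \<longrightarrow> branch S j = {})"
    if i: "i < length ts" for S i
  proof
    assume "S \<in> A i"
    then obtain S' where S': "S' \<in> even_sets d k (ts ! i)" "S = (#) i ` S'" by (auto simp: A_def)
    then have "S' \<noteq> {}" "S' \<subseteq> leaves (ts ! i)" "card S' = k" using k by (auto simp: even_sets_def)
    moreover from this S' i have "S \<subseteq> leaves (Node ts)" "card S = k"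
      by (auto simp: card_image)
    moreover have "induced S (Node ts) = induced S' (ts ! i)"
      using induced_single_branch[of S ts i] calculation S' i by simp
    ultimately show "S \<in> even_sets d k (Node ts) \<and> branch S i \<noteq> {} \<and> (\<forall>j. j \<noteq> i \<longrightarrow> branch S j = {})"
      using S' k by (simp add: even_sets_def)
  next
    assume S: "S \<in> even_sets d k (Node ts) \<and> branch S i \<noteq> {} \<and> (\<forall>j. j \<noteq> i \<longrightarrow> branch S j = {})"
    then have sl: "S \<subseteq> leaves (Node ts)" by (simp add: even_sets_def)
    have "S = (\<Union>j<d. (#) j ` branch S j)" using UN_Cons_branch[OF sl ts] by simp
    also have "\<dots> = (#) i ` branch S i" 
    proof (intro equalityI subsetI)
      fix x assume "x \<in> (\<Union>j<d. (#) j ` branch S j)"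
      then obtain j q where "x = j # q" "q \<in> branch S j" by blast
      then show "x \<in> (#) i ` branch S i" using S by (cases "j = i") auto
    qed (use i ts in auto)
    finally have eq: "S = (#) i ` branch S i" .
    then have "card S = card (branch S i)" by (metis card_image inj_on_Cons1)
    then have "branch S i \<in> even_sets d k (ts ! i)"
      using S induced_single_branch[OF sl i] branch_subset_leaves[OF sl i] k
      by (simp add: even_sets_def)
    then show "S \<in> A i" using eq by (auto simp: A_def)
  qed
  have split: "even_sets d k (Node ts) = (\<Union>i<length ts. A i) \<union> C"
  proof (intro set_eqI iffI)
    fix S assume S: "S \<in> even_sets d k (Node ts)"
    then have "S \<subseteq> leaves (Node ts)" "S \<noteq> {}" using k by (auto simp: even_sets_def)
    from this(1) ts(1) this(2) show "S \<in> (\<Union>i<length ts. A i) \<union> C"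
    proof (cases rule: leaf_set_cases)
      case (single i)
      then show ?thesis using A_char[of i S] S by auto
    next
      case branching
      then show ?thesis using S by (simp add: C_def branching_def)
    qed
  qed (auto simp: C_def A_char)
  have disj: "(\<Union>i<length ts. A i) \<inter> C = {}"
  proof -
    have False if i: "i < length ts" and S: "S \<in> A i" "S \<in> C" for i S
    proof -
      have "{j. j < length ts \<and> branch S j \<noteq> {}} \<subseteq> {i}" using A_char[OF i] S by auto
      then have "card {j. j < length ts \<and> branch S j \<noteq> {}} \<le> card {i}"
        by (intro card_mono) auto
      then show False using S by (simp add: C_def branching_def)
    qed
    then show ?thesis by blast
  qed
  have finA: "finite (A i)" for i by (simp add: A_def)
  have "A i \<inter> A j = {}" if "i < length ts" "j < length ts" "i \<noteq> j" for i j
    using A_char[OF that(1)] A_char[OF that(2)] that(3) by (metis disjoint_iff)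
  then have "card (\<Union>i<length ts. A i) = (\<Sum>i<length ts. card (A i))"
    using finA by (intro card_UN_disjoint) auto
  also have "\<dots> = (\<Sum>i<length ts. card (even_sets d k (ts ! i)))"
    unfolding A_def by (intro sum.cong refl card_image inj_on_image) auto
  finally have cA: "card (\<Union>i<length ts. A i) = (\<Sum>i<length ts. card (even_sets d k (ts ! i)))" .
  \<comment> \<open>Traces are recorded as functions on \<open>{..<d}\<close>, padded branches
    included; gluing the traces is the inverse map.\<close>
  have bij: "bij_betw (\<lambda>S. restrict (branch S) {..<d}) C (\<Union>B\<in>BB. P B)"
  proof (rule bij_betw_byWitness[where f'="\<lambda>f. \<Union>i<d. (#) i ` f i"])
    show "\<forall>S\<in>C. (\<Union>i<d. (#) i ` restrict (branch S) {..<d} i) = S"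
    proof
      fix S assume "S \<in> C"
      then have "(\<Union>i<d. (#) i ` branch S i) = S"
        using UN_Cons_branch[OF _ ts] by (simp add: C_def even_sets_def)
      then show "(\<Union>i<d. (#) i ` restrict (branch S) {..<d} i) = S"
        by simp
    qed
    show "\<forall>f\<in>\<Union>B\<in>BB. P B. restrict (branch (\<Union>i<d. (#) i ` f i)) {..<d} = f"
    proof
      fix f assume "f \<in> (\<Union>B\<in>BB. P B)"
      then have "f \<in> extensional {..<d}" by (auto simp: P_def PiE_def)
      then show "restrict (branch (\<Union>i<d. (#) i ` f i)) {..<d} = f"
        by (intro ext) (simp add: restrict_def extensional_def)
    qed
    show "(\<lambda>S. restrict (branch S) {..<d}) ` C \<subseteq> (\<Union>B\<in>BB. P B)"
    proof (rule image_subsetI)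
      fix S assume S: "S \<in> C"
      then have sl: "S \<subseteq> leaves (Node ts)" "card S = k" by (auto simp: C_def even_sets_def)
      define c where "c i = card (branch S i)" for i
      have c: "c i \<in> {k div d, k div d + 1}" "branch S i \<in> branch_sets d (c i) ts i" if "i < d" for i
        using even_sets_branching_iff[OF d k ts sl] S that by (auto simp: C_def branching_def c_def)
      let ?B = "{i. i < d \<and> c i = k div d + 1}"
      have "?B \<in> BB"
        unfolding BB_def using card_larger_parts[of d c k] c(1) card_eq_sum_branch[OF sl(1) ts] sl(2) d
        by (auto simp: c_def)
      moreover have "restrict (branch S) {..<d} \<in> P ?B"
      proof -
        have "c i = k div d + of_bool (i \<in> ?B)" if "i < d" for i using c(1)[OF that] that by auto
        then show ?thesis using c(2) by (force simp: P_def)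
      qed
      ultimately show "restrict (branch S) {..<d} \<in> (\<Union>B\<in>BB. P B)" by blast
    qed
    show "(\<lambda>f. \<Union>i<d. (#) i ` f i) ` (\<Union>B\<in>BB. P B) \<subseteq> C"
    proof (rule image_subsetI)
      fix f assume "f \<in> (\<Union>B\<in>BB. P B)"
      then obtain B where B: "B \<in> BB" and f: "f \<in> P B" by blast
      define S where "S = (\<Union>i<d. (#) i ` f i)"
      have fi: "f i \<in> branch_sets d (k div d + of_bool (i \<in> B)) ts i" if "i < d" for i
        using PiE_mem[OF f[unfolded P_def], of i] that by simp
      have br: "branch S i = f i" if "i < d" for i using that by (simp add: S_def)
      have card_f: "card (f i) = k div d + of_bool (i \<in> B)" "finite (f i)" if "i < d" for i
        using branch_sets_card[OF fi[OF that]] by auto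
      have "card S = (\<Sum>i<d. card (f i))"
        unfolding S_def using card_f by (intro card_UN_Cons) auto
      also have "\<dots> = (\<Sum>i<d. k div d + of_bool (i \<in> B))"
        using card_f by (intro sum.cong) auto
      also have "\<dots> = k" using B by (subst sum_of_bool) (auto simp: BB_def)
      finally have cS: "card S = k" .
      have small: "i < length ts" if "i < d" "f i \<noteq> {}" for i
        using fi[of i] that by (auto simp: branch_sets_def split: if_splits)
      have "f i \<subseteq> leaves (ts ! i)" if "i < length ts" for i
        using fi[of i] that ts by (auto simp: branch_sets_def even_sets_def)
      then have sl: "S \<subseteq> leaves (Node ts)"
        using small by (fastforce simp: S_def)
      have I: "{i. i < length ts \<and> branch S i \<noteq> {}} = {i. i < d \<and> f i \<noteq> {}}"
        using small br ts by auto
      have ne: "f i \<noteq> {}" if "i < d" "k div d + of_bool (i \<in> B) \<noteq> (0::nat)" for i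
        using card_f(1)[OF that(1)] that(2) by (metis card.empty)
      \<comment> \<open>A glued set must meet two branches: if \<open>k div d = 0\<close>, it meets
        those in \<open>B\<close>, of which there are \<open>k\<close>; otherwise it meets all
        \<open>d\<close>.\<close>
      have "branching S"
      proof (cases "k div d = 0")
        case True
        then have "k mod d = k" by (metis div_eq_0_iff mod_less mod_0 mod_by_0)
        then have "card B = k" "B \<subseteq> {..<d}" using B by (auto simp: BB_def)
        moreover have "B \<subseteq> {i. i < d \<and> f i \<noteq> {}}"
          using ne \<open>B \<subseteq> {..<d}\<close> by (auto simp: subset_iff)
        then have "card B \<le> card {i. i < d \<and> f i \<noteq> {}}" by (intro card_mono) auto
        ultimately show ?thesis using k by (simp add: branching_def I)
      next
        case False
        then have "{i. i < d \<and> f i \<noteq> {}} = {..<d}" using ne by auto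
        then show ?thesis using d by (simp add: branching_def I)
      qed
      moreover have "S \<in> even_sets d k (Node ts)"
      proof -
        have "card (branch S i) \<in> {k div d, k div d + 1} \<and>
            branch S i \<in> branch_sets d (card (branch S i)) ts i" if "i < d" for i
          unfolding br[OF that] card_f(1)[OF that] using fi[OF that] by simp
        then show ?thesis
          using even_sets_branching_iff[OF d k ts sl cS] \<open>branching S\<close>
          unfolding branching_def by blast
      qed
      ultimately show "(\<Union>i<d. (#) i ` f i) \<in> C" by (simp add: C_def S_def)
    qed
  qed
  have finBB: "finite BB" unfolding BB_def by (rule finite_subset[of _ "Pow {..<d}"]) auto
  \<comment> \<open>The sizes of the traces determine \<open>B\<close>, so the product sets are
    disjoint.\<close>
  have "P B \<inter> P B' = {}" if "B \<in> BB" "B' \<in> BB" "B \<noteq> B'" for B B'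
  proof (rule ccontr)
    assume "P B \<inter> P B' \<noteq> {}"
    then obtain f where f: "f \<in> P B" "f \<in> P B'" by blast
    have "i \<in> B \<longleftrightarrow> i \<in> B'" if "i < d" for i
    proof -
      have "f i \<in> branch_sets d (k div d + of_bool (i \<in> B)) ts i"
        "f i \<in> branch_sets d (k div d + of_bool (i \<in> B')) ts i"
        using PiE_mem[OF f(1)[unfolded P_def], of i] PiE_mem[OF f(2)[unfolded P_def], of i] that
        by simp_all
      then have "k div d + of_bool (i \<in> B) = k div d + of_bool (i \<in> B')"
        by (metis branch_sets_card)
      then show ?thesis by (simp add: of_bool_eq_iff)
    qed
    then show False using that by (auto simp: BB_def)
  qed
  then have "card (\<Union>B\<in>BB. P B) = (\<Sum>B\<in>BB. card (P B))"
    using finBB by (intro card_UN_disjoint) (auto simp: P_def intro!: finite_PiE)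
  also have "\<dots> = (\<Sum>B\<in>BB. \<Prod>i<d. card (branch_sets d (k div d + of_bool (i \<in> B)) ts i))"
    by (simp add: P_def card_PiE)
  finally have "card C = (\<Sum>B\<in>BB. \<Prod>i<d. card (branch_sets d (k div d + of_bool (i \<in> B)) ts i))"
    using bij_betw_same_card[OF bij] by simp
  moreover have "card (even_sets d k (Node ts)) = card (\<Union>i<length ts. A i) + card C"
    unfolding split by (rule card_Un_disjoint[OF _ _ disj]) (auto simp: A_def C_def)
  ultimately show ?thesis by (simp add: cA BB_def)
qed

section \<open>Leaf sets with at most two elements\<close>

fun reduced :: "tree \<Rightarrow> bool" where
  "reduced (Node ts) \<longleftrightarrow> length ts \<noteq> 1 \<and> (\<forall>t\<in>set ts. reduced t)"

lemma reduced_suppress: "reduced (suppress T)"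
  by (induction T rule: suppress.induct) auto

lemma length_le_num_leaves: "length ts \<le> num_leaves (Node ts)"
proof -
  have "(\<Sum>i<length ts. 1) \<le> (\<Sum>i<length ts. num_leaves (ts ! i))"
    using num_leaves_pos by (intro sum_mono) (simp add: Suc_le_eq)
  then show ?thesis by (simp add: num_leaves_Node)
qed

lemma reduced_num_leaves_1:
  assumes "reduced T" "num_leaves T = 1"
  shows "T = Node []"
proof (cases T)
  case (Node ts)
  then have "length ts \<noteq> 1" "length ts \<le> 1" using assms length_le_num_leaves[of ts] by auto
  then have "length ts = 0" by linarith
  then show ?thesis using Node by simp
qed

lemma reduced_num_leaves_2:
  assumes "reduced T" "num_leaves T = 2"
  shows "T = Node [Node [], Node []]"
proof (cases T)
  case (Node ts)
  have "ts \<noteq> []" using assms(2) Node by (auto simp: num_leaves_Node)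
  then have "length ts = 2"
    using assms length_le_num_leaves[of ts] Node by (cases "length ts") auto
  then obtain t u where ts: "ts = [t, u]" by (auto simp: length_Suc_conv numeral_2_eq_2)
  have "num_leaves t + num_leaves u = 2"
    using assms(2) by (simp add: Node ts num_leaves_Node lessThan_Suc numeral_2_eq_2)
  then have "num_leaves t = 1" "num_leaves u = 1"
    using num_leaves_pos[of t] num_leaves_pos[of u] by linarith+
  then show ?thesis using assms(1) reduced_num_leaves_1 by (simp add: Node ts)
qed

text \<open>A tree without unary vertices is determined by its number of leaves if this is one or
  two, so every leaf set of such a size counts; the empty set counts by convention.\<close>

lemma card_even_sets_le_2:
  assumes "d \<ge> 2" "k \<le> 2"
  shows "card (even_sets d k T) = num_leaves T choose k"
proof -
  have "canon (induced S T) = canon (even_tree d k)"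
    if S: "S \<subseteq> leaves T" "card S = k" "k \<noteq> 0" for S
  proof -
    have n: "num_leaves (induced S T) = k"
      using msize_induced[OF S(1)] S(2,3) by (force simp: msize_canon)
    have r: "reduced (induced S T)" by (simp add: induced_def reduced_suppress)
    have "k = 1 \<or> k = 2" using S(3) assms(2) by linarith
    then show ?thesis
    proof
      assume "k = 1"
      then show ?thesis using reduced_num_leaves_1[OF r] n by (simp add: canon_even_tree_le_1)
    next
      assume "k = 2"
      then show ?thesis
        using reduced_num_leaves_2[OF r] n assms(1) canon_even_tree_le[of d 2]
        by (simp add: numeral_2_eq_2)
    qed
  qed
  then have "even_sets d k T = {S. S \<subseteq> leaves T \<and> card S = k}"
    by (auto simp: even_sets_def)
  then show ?thesis by (simp add: n_subsets num_leaves_def)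
qed

lemma card_even_sets_leaf:
  assumes "k \<ge> 2"
  shows "card (even_sets d k (Node [])) = 0"
proof -
  have "S \<notin> even_sets d k (Node [])" for S
  proof
    assume "S \<in> even_sets d k (Node [])"
    then have S: "S \<subseteq> {[]}" "card S = k" by (simp_all add: even_sets_def leaves_Node)
    show False using card_mono[OF _ S(1)] S(2) assms by simp
  qed
  then have "even_sets d k (Node []) = {}" by blast
  then show ?thesis by simp
qed

section \<open>The upper bound for arbitrary \<open>d\<close>-ary trees\<close>

lemma prod_power_of_bool:
  fixes x :: "nat \<Rightarrow> real"
  assumes "B \<subseteq> {..<d}"
  shows "(\<Prod>i<d. x i ^ (s + of_bool (i \<in> B))) = (\<Prod>i<d. x i) ^ s * (\<Prod>i\<in>B. x i)"
proof -
  have "(\<Prod>i<d. x i ^ of_bool (i \<in> B)) = (\<Prod>i\<in>B. x i)"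
    using assms by (intro prod.mono_neutral_cong_right) auto
  then show ?thesis by (simp add: power_add prod.distrib prod_power_distrib)
qed

lemma prod_if_mem:
  fixes u v :: real
  assumes "B \<subseteq> {..<d}"
  shows "(\<Prod>i<d. if i \<in> B then v else u) = u ^ (d - card B) * v ^ card B"
proof -
  have "{..<d} \<inter> {i. i \<in> B} = B" "{..<d} \<inter> - {i. i \<in> B} = {..<d} - B" using assms by auto
  moreover have "finite B" using assms finite_subset by blast
  ultimately show ?thesis using assms by (simp add: prod.If_cases card_Diff_subset mult.commute)
qed

text \<open>Links the recursion to \<open>balanced_mean\<close>: such a sum appears in
  \<open>card_even_sets_Node\<close> once each factor is estimated by a power of the size of its
  branch.\<close>

lemma sum_balanced:
  assumes "d > 0"
  shows "(\<Sum>B | B \<subseteq> {..<d} \<and> card B = k mod d. \<Prod>i<d. x i ^ (k div d + of_bool (i \<in> B)))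
       = real (d choose (k mod d)) * balanced_mean d k x"
proof -
  have "k mod d \<le> d" using assms by (simp add: less_imp_le)
  then have "real (d choose (k mod d)) * balanced_mean d k x = (\<Prod>i<d. x i) ^ (k div d) * elem_sym d (k mod d) x"
    by (simp add: balanced_mean_def)
  also have "\<dots> = (\<Sum>B | B \<subseteq> {..<d} \<and> card B = k mod d. \<Prod>i<d. x i ^ (k div d + of_bool (i \<in> B)))"
    unfolding elem_sym_def sum_distrib_left by (intro sum.cong refl) (simp add: prod_power_of_bool)
  finally show ?thesis by simp
qed

text \<open>Let \<open>x i\<close> be the number of leaves of branch \<open>i\<close>, and 0 for a
  padded one. Copies inside single branches number at most \<open>a\<close> times the sum of the
  \<open>x i ^ k\<close>. The branching ones number at most
  \<open>a * (d ^ k - d) * balanced_mean d k x\<close> by the choice of \<open>a\<close>, and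
  \<open>balanced_mean_le\<close> bounds this by what is missing to \<open>a\<close> times the
  \<open>k\<close>-th power of the total.\<close>

lemma card_even_sets_upper:
  fixes a1 a2 :: real
  assumes d: "d \<ge> 2" and k: "k \<ge> 2"
  defines "s \<equiv> k div d" and "b \<equiv> k mod d"
  assumes a1: "\<And>T. dary d T \<Longrightarrow> real (card (even_sets d s T)) \<le> a1 * real (num_leaves T) ^ s"
    and a2: "\<And>T. dary d T \<Longrightarrow> real (card (even_sets d (Suc s) T)) \<le> a2 * real (num_leaves T) ^ Suc s"
    and pos: "a1 > 0" "a2 > 0"
    and a: "a * (real d ^ k - real d) = real (d choose b) * (a1 ^ (d - b) * a2 ^ b)"
  shows "dary d T \<Longrightarrow> real (card (even_sets d k T)) \<le> a * real (num_leaves T) ^ k"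
proof (induction T rule: vertices.induct)
  case (1 ts)
  have dk: "real d ^ k > real d" using d k power_strict_increasing[of 1 k "real d"] by simp
  have "a * (real d ^ k - real d) > 0"
    unfolding a using pos d by (simp add: b_def less_imp_le)
  then have a_pos: "a > 0" using dk by (simp add: zero_less_mult_iff)
  show ?case
  proof (cases "ts = []")
    case True
    then show ?thesis using k a_pos by (simp add: card_even_sets_leaf)
  next
    case False
    then have len: "length ts \<le> d" using "1.prems" by simp
    define x where "x i = (if i < length ts then real (num_leaves (ts ! i)) else 0)" for i
    have x: "x i \<ge> 0" for i by (simp add: x_def)
    \<comment> \<open>A padded branch has one admissible set of size 0, against the bound
      \<open>a1 * 0 ^ 0\<close>; the single vertex shows that \<open>a1\<close> is at least
      1.\<close>
    have a1_ge: "a1 \<ge> 1" if "s = 0"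
      using a1[of "Node []"] that by (simp add: even_sets_0)
    have branch_le: "real (card (branch_sets d (s + of_bool (i \<in> B)) ts i))
        \<le> (if i \<in> B then a2 else a1) * x i ^ (s + of_bool (i \<in> B))" for i B
      using a1[of "ts ! i"] a2[of "ts ! i"] "1.prems" pos a1_ge
      by (auto simp: branch_sets_def x_def power_0_left)
    have "real (card (even_sets d k (Node ts))) = (\<Sum>i<length ts. real (card (even_sets d k (ts ! i)))) +
      (\<Sum>B | B \<subseteq> {..<d} \<and> card B = b. \<Prod>i<d. real (card (branch_sets d (s + of_bool (i \<in> B)) ts i)))"
      using card_even_sets_Node[OF d k False len] by (simp add: s_def b_def)
    also have "\<dots> \<le> (\<Sum>i<length ts. a * x i ^ k) +
      (\<Sum>B | B \<subseteq> {..<d} \<and> card B = b. \<Prod>i<d. (if i \<in> B then a2 else a1) * x i ^ (s + of_bool (i \<in> B)))"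
      using 1 by (intro add_mono sum_mono prod_mono conjI branch_le) (auto simp: x_def)
    also have "(\<Sum>i<length ts. a * x i ^ k) = a * (\<Sum>i<d. x i ^ k)"
      unfolding sum_distrib_left using len k by (intro sum.mono_neutral_left) (auto simp: x_def)
    also have "(\<Sum>B | B \<subseteq> {..<d} \<and> card B = b. \<Prod>i<d. (if i \<in> B then a2 else a1) * x i ^ (s + of_bool (i \<in> B)))
      = a1 ^ (d - b) * a2 ^ b * (\<Sum>B | B \<subseteq> {..<d} \<and> card B = b. \<Prod>i<d. x i ^ (s + of_bool (i \<in> B)))"
      unfolding sum_distrib_left by (intro sum.cong refl) (simp add: prod.distrib prod_if_mem)
    also have "\<dots> = a * ((real d ^ k - real d) * balanced_mean d k x)"
      using sum_balanced[where d=d and k=k and x=x] d a by (simp add: s_def b_def mult_ac)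
    also have "\<dots> \<le> a * ((\<Sum>i<d. x i) ^ k - (\<Sum>i<d. x i ^ k))"
      using balanced_mean_le[of d x k] x d k a_pos by (intro mult_left_mono) auto
    also have "(\<Sum>i<d. x i) = real (num_leaves (Node ts))"
    proof -
      have "(\<Sum>i<d. x i) = (\<Sum>i<length ts. x i)"
        using len by (intro sum.mono_neutral_right) (auto simp: x_def)
      then show ?thesis using False by (simp add: num_leaves_Node x_def)
    qed
    finally show ?thesis by (simp add: algebra_simps)
  qed
qed

section \<open>Evenly spread strictly \<open>d\<close>-ary trees and the lower bound\<close>

lemma add_div_le:
  fixes d i m :: nat
  assumes "i < d"
  shows "(m + i) div d \<le> m"
proof -
  have "m + i < Suc m * d" using assms by (cases d) auto
  then have "(m + i) div d < Suc m" by (rule less_mult_imp_div_less)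
  then show ?thesis by simp
qed

text \<open>The second argument counts the internal vertices. Those below the root are shared out as
  \<open>(m + i) div d\<close>, numbers that differ by at most one.\<close>

function spread_tree :: "nat \<Rightarrow> nat \<Rightarrow> tree" where
  "spread_tree d 0 = Node []"
| "spread_tree d (Suc m) = Node (map (\<lambda>i. spread_tree d ((m + i) div d)) [0..<d])"
  by pat_completeness auto
termination
proof (relation "measure snd")
  fix d m i :: nat
  assume "i \<in> set [0..<d]"
  then have i: "i < d" by simp
  have "(m + i) div d \<le> m" using i by (rule add_div_le)
  then show "((d, (m + i) div d), (d, Suc m)) \<in> measure snd" by simp
qed auto

text \<open>A form of Hermite's identity: passing from \<open>m\<close> to \<open>Suc m\<close>
  drops the term \<open>m div d\<close> and adds \<open>(m + d) div d\<close>, which is larger by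
  one.\<close>

lemma sum_div_shift: "d > 0 \<Longrightarrow> (\<Sum>i<d. (m + i) div d) = (m::nat)"
proof (induction m)
  case (Suc m)
  have IH: "(\<Sum>i<d. (m + i) div d) = m" using Suc by simp
  have "(\<Sum>i<d. (m + i) div d) + (m + d) div d = (\<Sum>i<Suc d. (m + i) div d)"
    by (rule sum.lessThan_Suc[symmetric])
  also have "\<dots> = m div d + (\<Sum>i<d. (m + Suc i) div d)"
    by (subst sum.lessThan_Suc_shift) simp
  finally have "m + (m + d) div d = m div d + (\<Sum>i<d. (m + Suc i) div d)"
    unfolding IH .
  moreover have "(m + d) div d = m div d + 1" using Suc.prems by simp
  moreover have "(\<Sum>i<d. (Suc m + i) div d) = (\<Sum>i<d. (m + Suc i) div d)" by simp
  ultimately show ?case by linarith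
qed simp

lemma num_leaves_spread_tree:
  assumes "d \<ge> 2"
  shows "num_leaves (spread_tree d m) = (d - 1) * m + 1"
proof (induction m rule: less_induct)
  case (less m)
  show ?case
  proof (cases m)
    case (Suc c)
    have lt: "(c + i) div d < m" if "i < d" for i
      using add_div_le[OF that, of c] Suc by simp
    have "num_leaves (spread_tree d m) = (\<Sum>i<d. (d - 1) * ((c + i) div d) + 1)"
      using Suc assms less.IH lt by (simp add: num_leaves_Node)
    also have "\<dots> = (d - 1) * (\<Sum>i<d. (c + i) div d) + d"
      unfolding sum.distrib by (simp add: sum_distrib_left)
    also have "\<dots> = (d - 1) * c + d"
      using assms by (simp add: sum_div_shift)
    also have "\<dots> = (d - 1) * m + 1" using Suc assms by simp
    finally show ?thesis .
  qed (simp add: num_leaves_Node)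
qed

lemma strictly_dary_spread_tree: "strictly_dary d (spread_tree d m)"
  by (induction d m rule: spread_tree.induct) auto

lemma strictly_dary_imp_dary: "d \<ge> 2 \<Longrightarrow> strictly_dary d T \<Longrightarrow> dary d T"
proof (induction T rule: vertices.induct)
  case (1 ts)
  have "dary d t" if t: "t \<in> set ts" for t
  proof -
    obtain i where i: "i < length ts" "t = ts ! i" using t by (auto simp: in_set_conv_nth)
    have "strictly_dary d t" using "1.prems"(2) t by simp
    then show ?thesis using "1.IH"[of i] "1.prems"(1) i by simp
  qed
  then show ?case using "1.prems" by auto
qed

text \<open>The number of leaves of \<open>spread_tree d m\<close> plus \<open>d - 1\<close>. After this shift every branch has at
  least the \<open>d\<close>-th part of the size of the tree, so that no rounding errors enter the induction.\<close>

definition shifted_size :: "nat \<Rightarrow> nat \<Rightarrow> real" where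
  "shifted_size d m = real (d - 1) * (real m + 1) + 1"

lemma shifted_size_pos: "shifted_size d m > 0"
  by (simp add: shifted_size_def add_nonneg_pos)

text \<open>The smallest branch has \<open>m div d\<close> internal vertices, and
  \<open>m + 1\<close> is at most \<open>d * (m div d + 1)\<close>.\<close>

lemma shifted_size_branch:
  assumes "d \<ge> 2"
  shows "shifted_size d (Suc m) \<le> real d * shifted_size d ((m + i) div d)"
proof -
  have "m + 1 \<le> d * (m div d + 1)"
    using dividend_less_times_div[of d m] assms by simp
  also have "\<dots> \<le> d * ((m + i) div d + 1)"
    by (intro mult_left_mono add_mono div_le_mono) auto
  finally have "real (m + 1) \<le> real (d * ((m + i) div d + 1))"
    by (rule of_nat_mono)
  then have "real (d - 1) * real (m + 1) \<le> real (d - 1) * (real d * (real ((m + i) div d) + 1))"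
    by (intro mult_left_mono) (auto simp: algebra_simps)
  then show ?thesis
    using assms by (simp add: shifted_size_def of_nat_diff algebra_simps)
qed

text \<open>Truncation at 0 lets the lower bounds for the branches be replaced by a common value at
  \<open>z\<close> and multiplied, even where \<open>1 - C / z\<close> is negative.\<close>

lemma power_shrink_mono:
  fixes y z :: real
  assumes "0 < z" "z \<le> y" "0 \<le> C'" "C' \<le> C"
  shows "z ^ j * max 0 (1 - C / z) \<le> y ^ j * max 0 (1 - C' / y)"
proof -
  have "C' / y \<le> C / z" using assms by (intro frac_le) auto
  then show ?thesis using assms by (intro mult_mono power_mono) auto
qed

text \<open>Every branch is treated as if its shifted size were \<open>z = y / d\<close>, with
  \<open>y\<close> that of the whole tree. The main terms are \<open>d * a * z ^ k\<close> from
  single branches and \<open>a * (d ^ k - d) * z ^ k\<close> from branching sets, together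
  \<open>a * y ^ k\<close>. The second condition on \<open>C'\<close> ensures that the errors fit
  into \<open>a * C' * y ^ (k - 1)\<close>.\<close>

lemma card_even_sets_lower:
  fixes a1 a2 C C' :: real
  assumes d: "d \<ge> 2" and k: "k \<ge> 2"
  defines "s \<equiv> k div d" and "b \<equiv> k mod d"
  defines "N \<equiv> \<lambda>j m. real (card (even_sets d j (spread_tree d m)))"
  assumes a1: "\<And>m. a1 * (shifted_size d m ^ s * (1 - C / shifted_size d m)) \<le> N s m"
    and a2: "\<And>m. a2 * (shifted_size d m ^ Suc s * (1 - C / shifted_size d m)) \<le> N (Suc s) m"
    and pos: "a1 > 0" "a2 > 0" "C \<ge> 0"
    and a: "a * (real d ^ k - real d) = real (d choose b) * (a1 ^ (d - b) * a2 ^ b)"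
    and C': "C' \<ge> real d" "C' * (real d ^ (k - 1) - real d) \<ge> (real d ^ k - real d) * real d * C"
  shows "a * (shifted_size d m ^ k * (1 - C' / shifted_size d m)) \<le> N k m"
proof (induction m rule: less_induct)
  case (less m)
  let ?y = "shifted_size d"
  have dk: "real d ^ k > real d" using d k power_strict_increasing[of 1 k "real d"] by simp
  have "a * (real d ^ k - real d) > 0"
    unfolding a using pos d by (simp add: b_def less_imp_le)
  then have a_pos: "a > 0" using dk by (simp add: zero_less_mult_iff)
  show ?case
  proof (cases m)
    case 0
    \<comment> \<open>\<open>shifted_size d 0 = d\<close>, so the bound for the single vertex is not
      positive.\<close>
    have "?y 0 \<le> C'" using C'(1) d by (simp add: shifted_size_def of_nat_diff)
    then have "1 - C' / ?y 0 \<le> 0" using shifted_size_pos[of d 0] by simp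
    then have "a * (?y 0 ^ k * (1 - C' / ?y 0)) \<le> 0"
      using a_pos shifted_size_pos[of d 0] by (simp add: mult_nonneg_nonpos)
    then show ?thesis unfolding 0 by (rule order_trans) (simp add: N_def)
  next
    case (Suc c)
    let ?ts = "map (\<lambda>i. spread_tree d ((c + i) div d)) [0..<d]"
    define z where "z = ?y m / real d"
    have z: "z > 0" using shifted_size_pos d by (simp add: z_def)
    have zy: "z \<le> ?y ((c + i) div d)" for i
      using shifted_size_branch[OF d, of c i] d by (simp add: z_def Suc field_simps)
    have lower: "a' * (z ^ j * max 0 (1 - C'' / z)) \<le> N j ((c + i) div d)"
      if "a' * (?y ((c + i) div d) ^ j * (1 - C'' / ?y ((c + i) div d))) \<le> N j ((c + i) div d)"
        "a' > 0" "C'' \<ge> 0" for a' j C'' i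
    proof -
      let ?Y = "?y ((c + i) div d)"
      have "a' * (z ^ j * max 0 (1 - C'' / z)) \<le> a' * (?Y ^ j * max 0 (1 - C'' / ?Y))"
        using that(2,3) z zy by (intro mult_left_mono power_shrink_mono) auto
      also have "\<dots> \<le> N j ((c + i) div d)"
        using that(1) by (cases "1 - C'' / ?Y \<ge> 0") (auto simp: N_def max_def)
      finally show ?thesis .
    qed
    have lt: "(c + i) div d < m" if "i < d" for i
      using add_div_le[OF that, of c] Suc by simp
    define q where "q = max 0 (1 - C / z)"
    have bern: "1 - real d * (C / z) \<le> q ^ d"
    proof (cases "C / z \<le> 1")
      case True
      then show ?thesis using Bernoulli_inequality[of "- (C / z)" d] by (simp add: q_def)
    next
      case False
      then have "1 \<le> real d * (C / z)" using d mult_mono[of 1 "real d" 1 "C / z"] by simp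
      moreover have "0 \<le> q ^ d" by (simp add: q_def)
      ultimately show ?thesis by linarith
    qed
    have branch_ge: "(if i \<in> B then a2 else a1) * (z ^ (s + of_bool (i \<in> B)) * q)
        \<le> real (card (branch_sets d (s + of_bool (i \<in> B)) ?ts i))" if "i < d" for i B
      using lower[OF a1 pos(1,3), of i] lower[OF a2 pos(2,3), of i] that
      by (simp add: branch_sets_def N_def q_def)
    have prod_ge: "a1 ^ (d - b) * a2 ^ b * (z ^ k * q ^ d)
        \<le> (\<Prod>i<d. real (card (branch_sets d (s + of_bool (i \<in> B)) ?ts i)))"
      if B: "B \<subseteq> {..<d}" "card B = b" for B
    proof -
      have "(\<Prod>i<d. z ^ (s + of_bool (i \<in> B))) = z ^ k"
        unfolding power_sum[symmetric] sum_of_bool[OF B(1)] B(2) by (simp add: s_def b_def)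
      then have "a1 ^ (d - b) * a2 ^ b * (z ^ k * q ^ d)
          = (\<Prod>i<d. (if i \<in> B then a2 else a1) * (z ^ (s + of_bool (i \<in> B)) * q))"
        using B by (simp add: prod.distrib prod_if_mem)
      also have "\<dots> \<le> (\<Prod>i<d. real (card (branch_sets d (s + of_bool (i \<in> B)) ?ts i)))"
        using branch_ge pos z by (intro prod_mono) (auto simp: q_def)
      finally show ?thesis .
    qed
    have cardBB: "card {B. B \<subseteq> {..<d} \<and> card B = b} = d choose b"
      by (simp add: n_subsets)
    have "a * (?y m ^ k * (1 - C' / ?y m)) = a * z ^ k * (real d ^ k - real d ^ (k - 1) * (C' / z))"
      using d k shifted_size_pos[of d m]
      by (cases k) (simp_all add: z_def field_simps)
    \<comment> \<open>After cancelling the main terms this is the second condition on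
      \<open>C'\<close>, divided by \<open>z\<close>.\<close>
    also have "\<dots> \<le> a * z ^ k * (real d * (1 - C' / z) + (real d ^ k - real d) * (1 - real d * (C / z)))"
    proof (intro mult_left_mono)
      have "(real d ^ k - real d) * real d * C / z \<le> C' * (real d ^ (k - 1) - real d) / z"
        using C'(2) z by (intro divide_right_mono) auto
      then show "real d ^ k - real d ^ (k - 1) * (C' / z)
          \<le> real d * (1 - C' / z) + (real d ^ k - real d) * (1 - real d * (C / z))"
        by (simp add: algebra_simps diff_divide_distrib)
    qed (use a_pos z in auto)
    also have "\<dots> = real d * (a * (z ^ k * (1 - C' / z)))
        + (a * (real d ^ k - real d)) * (z ^ k * (1 - real d * (C / z)))"
      by (simp add: algebra_simps)
    also have "\<dots> \<le> (\<Sum>i<d. N k ((c + i) div d)) +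
        real (d choose b) * (a1 ^ (d - b) * a2 ^ b * (z ^ k * q ^ d))"
    proof (rule add_mono)
      have "a * (z ^ k * (1 - C' / z)) \<le> N k ((c + i) div d)" if "i < d" for i
      proof -
        have "a * (z ^ k * (1 - C' / z)) \<le> a * (z ^ k * max 0 (1 - C' / z))"
          using a_pos z by (intro mult_left_mono) auto
        also have "\<dots> \<le> N k ((c + i) div d)"
          using C'(1) a_pos by (intro lower less.IH lt that) auto
        finally show ?thesis .
      qed
      then have "(\<Sum>i<d. a * (z ^ k * (1 - C' / z))) \<le> (\<Sum>i<d. N k ((c + i) div d))"
        by (intro sum_mono) auto
      then show "real d * (a * (z ^ k * (1 - C' / z))) \<le> (\<Sum>i<d. N k ((c + i) div d))"
        by simp
    next
      show "(a * (real d ^ k - real d)) * (z ^ k * (1 - real d * (C / z)))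
          \<le> real (d choose b) * (a1 ^ (d - b) * a2 ^ b * (z ^ k * q ^ d))"
        unfolding a mult.assoc using pos z bern by (intro mult_left_mono) auto
    qed
    also have "\<dots> \<le> (\<Sum>i<d. N k ((c + i) div d)) +
        (\<Sum>B | B \<subseteq> {..<d} \<and> card B = b. \<Prod>i<d. real (card (branch_sets d (s + of_bool (i \<in> B)) ?ts i)))"
      using sum_bounded_below[of "{B. B \<subseteq> {..<d} \<and> card B = b}"
          "a1 ^ (d - b) * a2 ^ b * (z ^ k * q ^ d)"] prod_ge
      by (simp add: cardBB)
    also have "\<dots> = N k m"
      using card_even_sets_Node[OF d k, of ?ts] d
      by (simp add: N_def Suc s_def b_def)
    finally show ?thesis .
  qed
qed

text \<open>Both bounds share the coefficient \<open>a\<close>, which pins down the limit of the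
  densities. Sizes up to 2 are counted directly: the factor \<open>d ^ (k - 1) - d\<close> of
  \<open>C'\<close> in \<open>card_even_sets_lower\<close> vanishes for \<open>k = 2\<close> and is
  positive from \<open>k = 3\<close> on.\<close>

lemma card_even_sets_asymptotics:
  assumes d: "d \<ge> 2"
  shows "\<exists>a C. a > 0 \<and> C \<ge> 0 \<and>
    (\<forall>T. dary d T \<longrightarrow> real (card (even_sets d k T)) \<le> a * real (num_leaves T) ^ k) \<and>
    (\<forall>m. a * (shifted_size d m ^ k * (1 - C / shifted_size d m))
          \<le> real (card (even_sets d k (spread_tree d m))))"
proof (induction k rule: less_induct)
  case (less k)
  have n: "real (num_leaves (spread_tree d m)) = shifted_size d m - real (d - 1)" for m
    by (simp add: num_leaves_spread_tree[OF d] shifted_size_def distrib_left)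
  note y = shifted_size_pos[of d]
  consider "k = 0" | "k = 1" | "k = 2" | "k \<ge> 3" by linarith
  then show ?case
  proof cases
    case 1
    then show ?thesis
      by (intro exI[of _ 1] exI[of _ 0]) (simp add: even_sets_0)
  next
    case 2
    have "shifted_size d m * (1 - real (d - 1) / shifted_size d m) = shifted_size d m - real (d - 1)" for m
      using y[of m] by (simp add: field_simps)
    then show ?thesis using 2 d
      by (intro exI[of _ 1] exI[of _ "real (d - 1)"]) (simp add: card_even_sets_le_2 n)
  next
    case 3
    have c2: "real (n choose 2) = real n * (real n - 1) / 2" for n
      by (cases n) (simp_all add: choose_two real_of_nat_div field_simps)
    \<comment> \<open>With \<open>y\<close> the shifted size and \<open>n = y - (d - 1)\<close>
      leaves, \<open>n * (n - 1) = y ^ 2 - (2 * d - 1) * y + d * (d - 1)\<close>; dropping the last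
      term gives the constant \<open>2 * d - 1\<close>.\<close>
    have "shifted_size d m ^ 2 * (1 - (2 * real d - 1) / shifted_size d m)
        \<le> (shifted_size d m - real (d - 1)) * (shifted_size d m - real (d - 1) - 1)" for m
    proof -
      have "shifted_size d m ^ 2 * (1 - (2 * real d - 1) / shifted_size d m)
        = shifted_size d m ^ 2 - (2 * real d - 1) * shifted_size d m"
        using y[of m] by (simp add: field_simps power2_eq_square)
      also have "\<dots> \<le> \<dots> + real (d - 1) * real d" by simp
      also have "\<dots> = (shifted_size d m - real (d - 1)) * (shifted_size d m - real (d - 1) - 1)"
        using d by (simp add: of_nat_diff power2_eq_square algebra_simps)
      finally show ?thesis .
    qed
    moreover have "real m * (real m - 1) / 2 \<le> 1 / 2 * real m ^ 2" for m
      by (simp add: power2_eq_square algebra_simps)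
    ultimately show ?thesis using 3 d
      by (intro exI[of _ "1 / 2"] exI[of _ "2 * real d - 1"]) (simp add: card_even_sets_le_2 c2 n)
  next
    case 4
    define s b where "s = k div d" and "b = k mod d"
    have "s \<le> k div 2" unfolding s_def using d by (intro div_le_mono2) auto
    then have "s < k" "Suc s < k" using 4 by linarith+
    from less[OF this(1)] less[OF this(2)] obtain a1 C1 a2 C2 where
      pos: "a1 > 0" "C1 \<ge> 0" "a2 > 0" "C2 \<ge> 0" and
      u1: "\<And>T. dary d T \<Longrightarrow> real (card (even_sets d s T)) \<le> a1 * real (num_leaves T) ^ s" and
      u2: "\<And>T. dary d T \<Longrightarrow> real (card (even_sets d (Suc s) T)) \<le> a2 * real (num_leaves T) ^ Suc s" and
      l1: "\<And>m. a1 * (shifted_size d m ^ s * (1 - C1 / shifted_size d m))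
          \<le> real (card (even_sets d s (spread_tree d m)))" and
      l2: "\<And>m. a2 * (shifted_size d m ^ Suc s * (1 - C2 / shifted_size d m))
          \<le> real (card (even_sets d (Suc s) (spread_tree d m)))"
      by blast
    \<comment> \<open>One error constant for both sizes; raising it only weakens the lower
      bounds.\<close>
    define C where "C = max C1 C2"
    have weaken: "a' * (shifted_size d m ^ j * (1 - C / shifted_size d m)) \<le>
        a' * (shifted_size d m ^ j * (1 - C'' / shifted_size d m))" if "a' > 0" "C'' \<le> C" for a' C'' j m
      using that y[of m] by (intro mult_left_mono diff_mono divide_right_mono) auto
    have dk: "real d ^ k > real d" "real d ^ (k - 1) > real d"
      using d 4 power_strict_increasing[of 1 k "real d"] power_strict_increasing[of 1 "k - 1" "real d"] by auto
    define a where "a = real (d choose b) * (a1 ^ (d - b) * a2 ^ b) / (real d ^ k - real d)"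
    \<comment> \<open>The first entry serves the single vertex, the second solves the linear
      condition on \<open>C'\<close>.\<close>
    define C' where "C' = max (real d) ((real d ^ k - real d) * real d * C / (real d ^ (k - 1) - real d))"
    have a: "a * (real d ^ k - real d) = real (d choose b) * (a1 ^ (d - b) * a2 ^ b)"
      using dk by (simp add: a_def)
    have "b < d" using d by (simp add: b_def)
    then have "a > 0" using pos dk by (simp add: a_def)
    moreover have "C' \<ge> real d" by (simp add: C'_def)
    moreover have "(real d ^ k - real d) * real d * C \<le> C' * (real d ^ (k - 1) - real d)"
    proof -
      have "(real d ^ k - real d) * real d * C / (real d ^ (k - 1) - real d) \<le> C'" by (simp add: C'_def)
      then show ?thesis using dk by (simp add: divide_le_eq)
    qed
    moreover have "real (card (even_sets d k T)) \<le> a * real (num_leaves T) ^ k" if "dary d T" for T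
      by (rule card_even_sets_upper[OF d _ _ _ pos(1,3) _ that])
         (use 4 u1 u2 a in \<open>auto simp: s_def b_def\<close>)
    moreover have "a * (shifted_size d m ^ k * (1 - C' / shifted_size d m))
        \<le> real (card (even_sets d k (spread_tree d m)))" for m
    proof (rule card_even_sets_lower[OF d _ _ _ pos(1,3)])
      show "a1 * (shifted_size d m ^ (k div d) * (1 - C / shifted_size d m))
          \<le> real (card (even_sets d (k div d) (spread_tree d m)))" for m
        using weaken[OF pos(1), of C1 m s] l1[of m] by (simp add: C_def s_def)
      show "a2 * (shifted_size d m ^ Suc (k div d) * (1 - C / shifted_size d m))
          \<le> real (card (even_sets d (Suc (k div d)) (spread_tree d m)))" for m
        using weaken[OF pos(3), of C2 m "Suc s"] l2[of m] by (simp add: C_def s_def)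
    qed (use 4 a calculation pos in \<open>auto simp: b_def C_def\<close>)
    ultimately show ?thesis by (intro exI[of _ a] exI[of _ C']) auto
  qed
qed

section \<open>Densities\<close>

text \<open>The product of the factors \<open>1 - j / n\<close> with \<open>j < k\<close> is at
  least 1 minus the sum of the \<open>j / n\<close>. The square is a roomier bound that passes
  through the induction because \<open>k ^ 2 + k\<close> is at most
  \<open>(k + 1) ^ 2\<close>.\<close>

lemma fact_binomial_lower:
  assumes "k \<le> n" "n \<ge> 1"
  shows "real n ^ k * (1 - real k ^ 2 / real n) \<le> fact k * real (n choose k)"
  using assms(1)
proof (induction k)
  case (Suc k)
  have n: "real n > 0" using assms(2) by simp
  have "1 - real (Suc k) ^ 2 / real n \<le> (1 - real k ^ 2 / real n) * (1 - real k / real n)"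
  proof -
    have "(1 - real k ^ 2 / real n) * (1 - real k / real n)
        = 1 - (real k ^ 2 + real k) / real n + real k ^ 2 / real n * (real k / real n)"
      using n by (simp add: field_simps power2_eq_square)
    also have "\<dots> \<ge> 1 - (real k ^ 2 + real k) / real n" by simp
    finally have "1 - (real k ^ 2 + real k) / real n
        \<le> (1 - real k ^ 2 / real n) * (1 - real k / real n)" .
    moreover have "(real k ^ 2 + real k) / real n \<le> real (Suc k) ^ 2 / real n"
      by (intro divide_right_mono) (simp_all add: power2_eq_square algebra_simps)
    ultimately show ?thesis by linarith
  qed
  then have "real n ^ Suc k * (1 - real (Suc k) ^ 2 / real n)
      \<le> real n ^ Suc k * ((1 - real k ^ 2 / real n) * (1 - real k / real n))"
    by (intro mult_left_mono) auto
  also have "\<dots> = (real n ^ k * (1 - real k ^ 2 / real n)) * (real n - real k)"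
    using n by (simp add: field_simps)
  also have "\<dots> \<le> (fact k * real (n choose k)) * (real n - real k)"
    using Suc by (intro mult_right_mono) auto
  also have "\<dots> = fact (Suc k) * real (n choose Suc k)"
  proof -
    have "real (n choose k) * real (n - k) = real (Suc k) * real (n choose Suc k)"
      using binomial_absorb_comp[of n k] binomial_absorption[of k n]
      by (metis mult.commute of_nat_mult)
    then show ?thesis using Suc.prems by (simp add: of_nat_diff algebra_simps)
  qed
  finally show ?case .
qed simp

lemma fact_binomial_upper: "fact k * real (n choose k) \<le> real n ^ k"
proof -
  have "real ((n choose k) * fact k) \<le> real (n ^ k)"
    using binomial_fact_pow[of n k] of_nat_mono by blast
  then show ?thesis by (simp add: mult.commute)
qed

lemma finite_densities: "finite {density D T | T. P T \<and> num_leaves T = n}"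
proof (rule finite_subset)
  have "copies D T \<le> 2 ^ num_leaves T" for T
    unfolding copies_def num_leaves_def card_Pow[OF finite_leaves, symmetric]
    by (rule card_mono) auto
  then show "{density D T | T. P T \<and> num_leaves T = n}
      \<subseteq> (\<lambda>j. real j / real (n choose num_leaves D)) ` {..2 ^ n}"
    by (auto simp: density_def)
qed simp

text \<open>Binary caterpillars are the witnesses. With \<open>finite_densities\<close> this makes
  the maximum in \<open>inducibility\<close> a genuine one for each positive number of
  leaves.\<close>

lemma ex_dary_num_leaves: "d \<ge> 2 \<Longrightarrow> \<exists>T. dary d T \<and> num_leaves T = Suc n"
proof (induction n)
  case 0
  then show ?case by (intro exI[of _ "Node []"]) (simp add: num_leaves_Node)
next
  case (Suc n)
  then obtain T where "dary d T" "num_leaves T = Suc n" by blast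
  then show ?case using Suc.prems
    by (intro exI[of _ "Node [Node [], T]"]) (simp add: num_leaves_Node lessThan_Suc numeral_2_eq_2)
qed

text \<open>With \<open>n\<close> leaves and \<open>u = k ^ 2 / n\<close>, the binomial coefficient
  is at least \<open>(1 - u) * n ^ k / k!\<close>, and \<open>1 / (1 - u)\<close> is at most
  \<open>1 + 2 * u\<close> for \<open>u\<close> up to \<open>1 / 2\<close>, hence the lower bound on
  the number of leaves.\<close>

lemma density_even_tree_upper:
  assumes "d \<ge> 2" "k \<ge> 1" "a \<ge> 0"
    and "real (card (even_sets d k T)) \<le> a * real (num_leaves T) ^ k"
    and n: "num_leaves T \<ge> 2 * k ^ 2"
  shows "density (even_tree d k) T \<le> fact k * a * (1 + 2 * real k ^ 2 / real (num_leaves T))"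
proof -
  let ?n = "num_leaves T"
  define u where "u = real k ^ 2 / real ?n"
  have n0: "real ?n > 0" using num_leaves_pos by simp
  have "2 * real k ^ 2 \<le> real ?n"
    using of_nat_mono[OF n, where 'a=real] by simp
  then have u: "0 \<le> u" "u \<le> 1 / 2" using n0 by (simp_all add: u_def divide_le_eq)
  have "k \<le> ?n" using n self_le_power[of k 2] assms(2) by linarith
  then have c: "real (?n choose k) > 0" by simp
  have "u * (2 * u) \<le> u * 1" using u by (intro mult_left_mono) auto
  then have "1 \<le> (1 - u) * (1 + 2 * u)" by (simp add: algebra_simps)
  then have "real ?n ^ k \<le> real ?n ^ k * ((1 - u) * (1 + 2 * u))"
    using mult_left_mono[of 1 _ "real ?n ^ k"] by simp
  also have "\<dots> \<le> fact k * real (?n choose k) * (1 + 2 * u)"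
    using mult_right_mono[OF fact_binomial_lower[OF \<open>k \<le> ?n\<close>], of "1 + 2 * u"] u n0
    by (simp add: u_def mult.assoc)
  finally have "a * real ?n ^ k \<le> a * (fact k * real (?n choose k) * (1 + 2 * u))"
    using assms(3) by (rule mult_left_mono)
  then have "real (card (even_sets d k T)) \<le> fact k * a * (1 + 2 * u) * real (?n choose k)"
    using assms(4) by (simp add: mult_ac)
  then show ?thesis
    using c assms(1,2) by (simp add: density_def copies_even_tree num_leaves_even_tree divide_le_eq u_def)
qed

text \<open>\<open>y\<close> will be the shifted size, which exceeds the number \<open>n\<close> of
  leaves. Replacing \<open>y\<close> by \<open>n\<close> lowers both \<open>y ^ k\<close> and
  \<open>1 - C / y\<close>, and \<open>n ^ k\<close> is at least \<open>k!\<close> times the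
  binomial coefficient.\<close>

lemma density_even_tree_lower:
  assumes "d \<ge> 2" "k \<ge> 1" "a \<ge> 0" "C \<ge> 0"
    and N: "a * (y ^ k * (1 - C / y)) \<le> real (card (even_sets d k T))"
    and n: "num_leaves T \<ge> k" "real (num_leaves T) \<ge> C" "real (num_leaves T) \<le> y"
  shows "fact k * a * (1 - C / real (num_leaves T)) \<le> density (even_tree d k) T"
proof -
  let ?n = "num_leaves T"
  have n0: "real ?n > 0" using num_leaves_pos by simp
  have c: "real (?n choose k) > 0" using n by simp
  have C: "0 \<le> 1 - C / real ?n" "1 - C / real ?n \<le> 1 - C / y"
    using n n0 assms(4) frac_le[of C C "real ?n" y] by (simp_all add: divide_le_eq)
  have "fact k * a * (1 - C / real ?n) * real (?n choose k)
      = a * ((fact k * real (?n choose k)) * (1 - C / real ?n))" by simp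
  also have "\<dots> \<le> a * (y ^ k * (1 - C / y))"
  proof (intro mult_left_mono mult_mono)
    show "fact k * real (?n choose k) \<le> y ^ k"
      using fact_binomial_upper[of k ?n] power_mono[OF n(3), of k] by simp
  qed (use C n n0 assms(3) in auto)
  finally show ?thesis
    using N c assms(1,2) by (simp add: density_def copies_even_tree num_leaves_even_tree le_divide_eq)
qed

theorem mainTheorem10:
  fixes d k :: nat
  assumes "d \<ge> 2" and "k \<ge> 1"
  shows "(\<lambda>n. Max {density (even_tree d k) T | T.
                      strictly_dary d T \<and> num_leaves T = (d - 1) * n + 1}
              - inducibility d (even_tree d k))
           \<in> O(\<lambda>n. 1 / real n)"
proof -
  obtain a C where a: "a > 0" and C: "C \<ge> 0"
    and upper: "\<And>T. dary d T \<Longrightarrow> real (card (even_sets d k T)) \<le> a * real (num_leaves T) ^ k"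
    and lower: "\<And>m. a * (shifted_size d m ^ k * (1 - C / shifted_size d m))
          \<le> real (card (even_sets d k (spread_tree d m)))"
    using card_even_sets_asymptotics[OF assms(1), of k] by blast
  \<comment> \<open>About \<open>a * n ^ k\<close> copies among about \<open>n ^ k / k!\<close> leaf
    sets; \<open>L\<close> turns out to be the inducibility.\<close>
  define L where "L = fact k * a"
  have L: "L > 0" using a by (simp add: L_def)
  let ?\<gamma> = "density (even_tree d k)"
  let ?r = "\<lambda>m. (d - 1) * m + 1"
  define M where "M n = Max {?\<gamma> T | T. dary d T \<and> num_leaves T = n}" for n
  define S where "S m = Max {?\<gamma> T | T. strictly_dary d T \<and> num_leaves T = ?r m}" for m
  define K where "K = 2 * real k ^ 2"
  have r_ge: "m \<le> ?r m" for m
    using assms(1) mult_le_mono1[of 1 "d - 1" m] by linarith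
  have up: "?\<gamma> T \<le> L * (1 + K / real n)" if "dary d T" "num_leaves T = n" "n \<ge> 2 * k ^ 2" for T n
    using density_even_tree_upper[OF assms, of a T] upper[OF that(1)] a that
    by (simp add: L_def K_def)
  have lo: "L * (1 - C / real (?r m)) \<le> ?\<gamma> (spread_tree d m)" if "m \<ge> k" "real m \<ge> C" for m
  proof -
    have n: "num_leaves (spread_tree d m) = ?r m" by (rule num_leaves_spread_tree[OF assms(1)])
    have "real (?r m) \<ge> C" using that(2) of_nat_mono[OF r_ge[of m], where 'a=real] by linarith
    moreover have "?r m \<ge> k" using r_ge[of m] that(1) by linarith
    moreover have "real (?r m) \<le> shifted_size d m"
      by (simp add: shifted_size_def distrib_left)
    ultimately show ?thesis
      using density_even_tree_lower[OF assms _ C lower, of m] a by (simp add: L_def n)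
  qed
  have lo_S: "L * (1 - C / real (?r m)) \<le> S m" if "m \<ge> k" "real m \<ge> C" for m
    unfolding S_def
    by (rule order_trans[OF lo[OF that] Max_ge[OF finite_densities]])
       (use strictly_dary_spread_tree num_leaves_spread_tree[OF assms(1)] in blast)
  have lo_M: "L * (1 - C / real (?r m)) \<le> M (?r m)" if "m \<ge> k" "real m \<ge> C" for m
    unfolding M_def
    by (rule order_trans[OF lo[OF that] Max_ge[OF finite_densities]])
       (use strictly_dary_imp_dary[OF assms(1) strictly_dary_spread_tree]
          num_leaves_spread_tree[OF assms(1)] in blast)
  have up_M: "M n \<le> L * (1 + K / real n)" if "n \<ge> 2 * k ^ 2" "n \<ge> 1" for n
  proof -
    obtain T where "dary d T" "num_leaves T = n"
      using ex_dary_num_leaves[OF assms(1), of "n - 1"] \<open>n \<ge> 1\<close> by auto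
    then show ?thesis
      unfolding M_def using up that(1) by (subst Max_le_iff[OF finite_densities]) auto
  qed
  have up_S: "S m \<le> L * (1 + K / real (?r m))" if "m \<ge> 2 * k ^ 2" for m
  proof -
    have "?r m \<ge> 2 * k ^ 2" using that r_ge[of m] by linarith
    then show ?thesis
      unfolding S_def
      using up strictly_dary_imp_dary[OF assms(1)] strictly_dary_spread_tree
        num_leaves_spread_tree[OF assms(1)]
      by (subst Max_le_iff[OF finite_densities]) blast+
  qed
  have "limsup (\<lambda>n. ereal (M n)) = ereal L"
  proof (rule antisym)
    have "(\<lambda>n. L * (1 + K / real n)) \<longlonglongrightarrow> L * (1 + 0)"
      by (intro tendsto_intros lim_const_over_n)
    then have "limsup (\<lambda>n. ereal (L * (1 + K / real n))) = ereal L"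
      by (intro lim_imp_Limsup) auto
    moreover have "eventually (\<lambda>n. ereal (M n) \<le> ereal (L * (1 + K / real n))) sequentially"
      using eventually_ge_at_top[of "2 * k ^ 2"] eventually_ge_at_top[of 1]
      by eventually_elim (use up_M in simp)
    then have "limsup (\<lambda>n. ereal (M n)) \<le> limsup (\<lambda>n. ereal (L * (1 + K / real n)))"
      by (rule Limsup_mono)
    ultimately show "limsup (\<lambda>n. ereal (M n)) \<le> ereal L" by simp
  next
    \<comment> \<open>The lower bound comes from strictly \<open>d\<close>-ary trees, hence only for
      the sizes \<open>?r m\<close>; for a \<open>limsup\<close> a subsequence suffices.\<close>
    have mono: "strict_mono ?r" using assms(1) by (auto simp: strict_mono_def)
    have "(\<lambda>n. C / real n) \<longlonglongrightarrow> 0" by (rule lim_const_over_n)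
    from LIMSEQ_subseq_LIMSEQ[OF this mono]
    have "(\<lambda>m. C / real (?r m)) \<longlonglongrightarrow> 0" by (simp only: comp_def)
    then have "(\<lambda>m. L * (1 - C / real (?r m))) \<longlonglongrightarrow> L * (1 - 0)"
      by (intro tendsto_intros)
    then have "ereal L = limsup (\<lambda>m. ereal (L * (1 - C / real (?r m))))"
      by (intro lim_imp_Limsup[symmetric]) auto
    also have "\<dots> \<le> limsup (\<lambda>m. ereal (M (?r m)))"
    proof (rule Limsup_mono)
      show "eventually (\<lambda>m. ereal (L * (1 - C / real (?r m))) \<le> ereal (M (?r m))) sequentially"
        using eventually_ge_at_top[of k] eventually_ge_at_top[of "nat \<lceil>C\<rceil>"]
        by eventually_elim (use lo_M in \<open>simp add: nat_ceiling_le_eq\<close>)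
    qed
    also have "\<dots> \<le> limsup (\<lambda>n. ereal (M n))"
      using limsup_subseq_mono[OF mono, of "\<lambda>n. ereal (M n)"] by (simp only: comp_def)
    finally show "ereal L \<le> limsup (\<lambda>n. ereal (M n))" .
  qed
  then have I: "inducibility d (even_tree d k) = L"
    by (simp add: inducibility_def M_def)
  have "(\<lambda>m. S m - L) \<in> O(\<lambda>m. 1 / real m)"
  proof (rule bigoI)
    \<comment> \<open>\<open>K\<close> and \<open>C\<close> are the error constants from above and
      from below, so their sum serves both sides; since \<open>?r m\<close> is at least
      \<open>m\<close>, the errors may be stated with \<open>1 / m\<close>.\<close>
    show "eventually (\<lambda>m. norm (S m - L) \<le> L * (K + C) * norm (1 / real m)) sequentially"
      using eventually_ge_at_top[of k] eventually_ge_at_top[of "nat \<lceil>C\<rceil>"]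
        eventually_ge_at_top[of "2 * k ^ 2"] eventually_gt_at_top[of 0]
    proof eventually_elim
      case (elim m)
      have le: "c / real (?r m) \<le> (K + C) / real m" if "0 \<le> c" "c \<le> K + C" for c
        using that elim(4) of_nat_mono[OF r_ge[of m], where 'a=real] by (intro frac_le) auto
      have "S m - L \<le> L * (K / real (?r m))"
        using up_S[OF elim(3)] by (simp add: distrib_left)
      also have "\<dots> \<le> L * ((K + C) / real m)"
        using L C by (intro mult_left_mono le) (auto simp: K_def)
      finally have 1: "S m - L \<le> L * ((K + C) / real m)" .
      have "L - S m \<le> L * (C / real (?r m))"
        using lo_S[OF elim(1)] elim(2) by (simp add: right_diff_distrib nat_ceiling_le_eq)
      also have "\<dots> \<le> L * ((K + C) / real m)"
        using L C by (intro mult_left_mono le) (auto simp: K_def)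
      finally show ?case using 1 elim(4) by (simp add: abs_le_iff)
    qed
  qed
  then show ?thesis by (simp only: I S_def)
qed

end
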